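(* Let $\mathcal X$ be a nonempty open subset of $\mathbb R^n$, let $G$ be a Lie group acting smoothly on $\mathcal X$ via $\alpha$, let $\rho\in\mathcal P(\mathcal X)$ satisfy $\rho\ll\mathcal L^n$, let $c:\mathcal X\times\mathcal X\to\mathbb R$ be Borel-measurable, let $g_0,g_1\in G$, and set $\mu_i=\alpha(g_i)_\#\rho$ for $i=0,1$. Then the following statements hold. (i) $\mathds M_c(\mu_0,\mu_1)\le \mathds J_c(g_0,g_1)$. (ii) Suppose that $\mathds K_c(\mu_0,\mu_1)<\infty$, that $c$ satisfies Assumptions A and C of the context, and that the pair $(c,\mu_0)$ satisfies Assumption B of the context. Suppose further that there exist $h\in\mathrm{Stab}_G(\rho)$ and a $c$-convex function $\varphi$ such that the map $T_h=\alpha(g_1hg_0^{-1})$ satisfies $$\nabla_{x}\varphi(x)+\nabla_{x}c(x,T_h(x))=0\qquad \text{for }\mu_0\text{-almost every }x,$$ where $\nabla_x c(x,T_h(x))$ denotes the gradient of $c$ in its first argument evaluated at $(x,T_h(x))$. Then: (a) $T_h$ solves the Monge problem between $\mu_0$ and $\mu_1$, and it is the unique optimal Monge map up to $\mu_0$-almost everywhere equality; (b) $h$ solves the Lie group orbit transport problem defining $\mathds J_c(g_0,g_1)$, i.e. $h$ attains its infimum; (c) $(\mathrm{id}_{\mathcal X},T_h)_\#\mu_0$ solves the Kantorovich problem between $\mu_0$ and $\mu_1$, and it is the unique optimal Kantorovich plan; (d) $\mathds K_c(\mu_0,\mu_1)=\mathds M_c(\mu_0,\mu_1)=\mathds J_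c(g_0,g_1)$.
   Context: $\mathcal P(\mathcal X)$ is the set of Borel probability measures on $\mathcal X$; $\mathcal L^n$ is Lebesgue measure; $T_\#\mu(A)=\mu(T^{-1}(A))$; $\bar{\mathbb R}=\mathbb R\cup\{+\infty\}$. The smooth action is given by a group homomorphism $\alpha:G\to\mathrm{Diff}(\mathcal X)$ into the $C^\infty$ diffeomorphisms of $\mathcal X$ such that $(g,x)\mapsto\alpha(g)(x)$ is smooth. $\mathrm{Stab}_G(\rho)=\{h\in G:\alpha(h)_\#\rho=\rho\}$. Monge problem: $\mathds M_c(\mu_0,\mu_1)=\inf_{T}\int_{\mathcal X}c(x,T(x))\,d\mu_0(x)$, the infimum over Borel maps $T:\mathcal X\to\mathcal X$ with $T_\#\mu_0=\mu_1$. Kantorovich problem: $\mathds K_c(\mu_0,\mu_1)=\inf_{\Gamma\in\Pi(\mu_0,\mu_1)}\int c\,d\Gamma$, where $\Pi(\mu_0,\mu_1)$ is the set of probability measures on $\mathcal X\times\mathcal X$ with marginals $\mu_0,\mu_1$. Lie group orbit transport problem: $\mathds J_c(g_0,g_1)=\inf_{h\in\mathrm{Stab}_G(\rho)}\int_{\mathcal X}c(\alpha(g_0)(x),\alpha(g_1h)(x))\,d\rho(x)$. A function $\psi:\mathcal X\to\bar{\mathbb R}$ is $c$-convex if it is not identically $+\infty$ and there is $\phi:\mathcal X\to\mathbb R\cup\{\pm\infty\}$ with $\psi(x)=\sup_{y\in\mathcal X}\{\phi(y)-c(x,y)\}$ for all $x\in\mathcal X$. Its $c$-subdifferential at $x$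 is $\partial^c\psi(x)=\{y\in\mathcal X:\psi(z)\ge\psi(x)+c(x,y)-c(z,y)\ \forall z\in\mathcal X\}$, and $\mathrm{dom}(\partial^c\psi)=\{x\in\mathcal X:\partial^c\psi(x)\ne\varnothing\}$. Assumption A (on $c$): $c$ is continuous and bounded below; for every $y\in\mathcal X$ the map $x\mapsto c(x,y)$ is $C^1$ on $\mathcal X$; and for every $x\in\mathcal X$ the map $\mathcal X\ni y\mapsto\nabla_xc(x,y)\in\mathbb R^n$ is injective. Assumption B (on $(c,\mu_0)$): every $c$-convex function $\psi:\mathcal X\to\bar{\mathbb R}$ is differentiable $\mu_0$-almost everywhere on $\mathrm{dom}(\partial^c\psi)$. Assumption C (on $c$; condition $(H_\infty)$): for $S\subseteq\mathcal X$ and $x\in\overline S$ let $\mathcal T(S,x)=\{\lim_{k\to\infty}(x_k-x)/t_k: x_k\in S,\ x_k\to x,\ t_k>0,\ t_k\to0\}$ be the tangent cone. Then: (1) for every $x\in\mathcal X$ and every measurable $S\subseteq\mathcal X$ whose tangent cone $\mathcal T(S,x)$ is not contained in a half-space, there exist points $z_1,\dots,z_k\in S$ and a ball $B\subseteq\mathcal X$ containing $x$ such that, for all $y$ outside a compact subset of $\mathcal X$, $\inf_{w\in B}c(w,y)\ge\inf_{1\le j\le k}c(z_j,y)$; (2) for every $x\in\mathcal X$ and every neighborhood $U\subseteq\mathcal X$ of $x$ there is a ball $B\subseteq\mathcal X$ containing $x$ such that $\lim_{y\to\infty}\sup_{w\in B}\inf_{z\in U}\{c(z,y)-c(w,y)\}=-\infty$.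 Here $y\to\infty$ means that $y$ eventually leaves every compact subset of $\mathcal X$. *)

theory Defs
  imports "HOL-Probability.Probability_Measure" "HOL-Algebra.Bij"
begin

section \<open>Smooth manifolds, Lie groups and smooth actions\<close>

text \<open>
  The model space of a manifold is a linear subspace \<open>V\<close> of a Euclidean space rather than a whole
  Euclidean type, because the latter has dimension at least one, which would rule out
  zero-dimensional (discrete) Lie groups.  Differentiability is therefore phrased through
  directional derivatives along \<open>V\<close>: for \<open>U\<close> relatively open in \<open>V\<close>, \<open>Ck_on k V U f\<close> says
  that all iterated directional derivatives of \<open>f\<close> of order at most \<open>k\<close> exist and are continuous
  on \<open>U\<close>.  Only the values of \<open>f\<close> on \<open>U\<close> matter.
\<close>

primrec Ck_on ::
  "nat \<Rightarrow> 'a::real_normed_vector set \<Rightarrow> 'a set \<Rightarrow> ('a \<Rightarrow> 'b::real_normed_vector) \<Rightarrow> bool" where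
  "Ck_on 0 V U f \<longleftrightarrow> continuous_on U f"
| "Ck_on (Suc k) V U f \<longleftrightarrow> continuous_on U f \<and>
     (\<forall>v\<in>V. \<exists>g. (\<forall>x\<in>U. ((\<lambda>t. f (x + t *\<^sub>R v)) has_vector_derivative g x) (at 0)) \<and> Ck_on k V U g)"

definition smooth_on ::
  "'a::real_normed_vector set \<Rightarrow> 'a set \<Rightarrow> ('a \<Rightarrow> 'b::real_normed_vector) \<Rightarrow> bool" where
  "smooth_on V U f \<longleftrightarrow> (\<forall>k. Ck_on k V U f)"

record ('a, 'e) mfd =
  mtop :: "'a topology"
  model :: "'e set"
  charts :: "('a set \<times> ('a \<Rightarrow> 'e)) set"

text \<open>The atlas need not be maximal; smoothness of maps does not depend on maximality.\<close>

definition smooth_manifold :: "('a, 'e::euclidean_space) mfd \<Rightarrow> bool" where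
  "smooth_manifold M \<longleftrightarrow>
     Hausdorff_space (mtop M) \<and> second_countable (mtop M) \<and> subspace (model M) \<and>
     (\<Union>(U, \<phi>)\<in>charts M. U) = topspace (mtop M) \<and>
     (\<forall>(U, \<phi>)\<in>charts M.
        openin (mtop M) U \<and> openin (top_of_set (model M)) (\<phi> ` U) \<and>
        homeomorphic_map (subtopology (mtop M) U) (top_of_set (\<phi> ` U)) \<phi>) \<and>
     (\<forall>(U, \<phi>)\<in>charts M. \<forall>(V, \<psi>)\<in>charts M.
        smooth_on (model M) (\<phi> ` (U \<inter> V)) (\<psi> \<circ> inv_into U \<phi>))"

definition smooth_map ::
  "('a, 'e::euclidean_space) mfd \<Rightarrow> ('b, 'f::euclidean_space) mfd \<Rightarrow> ('a \<Rightarrow> 'b) \<Rightarrow> bool" where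
  "smooth_map M N f \<longleftrightarrow> continuous_map (mtop M) (mtop N) f \<and>
     (\<forall>(U, \<phi>)\<in>charts M. \<forall>(V, \<psi>)\<in>charts N.
        smooth_on (model M) (\<phi> ` (U \<inter> f -` V)) (\<psi> \<circ> f \<circ> inv_into U \<phi>))"

definition prod_mfd :: "('a, 'e) mfd \<Rightarrow> ('b, 'f) mfd \<Rightarrow> ('a \<times> 'b, 'e \<times> 'f) mfd" where
  "prod_mfd M N = \<lparr> mtop = prod_topology (mtop M) (mtop N), model = model M \<times> model N,
     charts = {(U \<times> V, map_prod \<phi> \<psi>) | U \<phi> V \<psi>. (U, \<phi>) \<in> charts M \<and> (V, \<psi>) \<in> charts N} \<rparr>"

definition open_mfd :: "'a::euclidean_space set \<Rightarrow> ('a, 'a) mfd" where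
  "open_mfd X = \<lparr> mtop = top_of_set X, model = UNIV, charts = {(X, id)} \<rparr>"

definition lie_group :: "('g, 'm) monoid_scheme \<Rightarrow> ('g, 'e::euclidean_space) mfd \<Rightarrow> bool" where
  "lie_group G M \<longleftrightarrow> group G \<and> smooth_manifold M \<and> topspace (mtop M) = carrier G \<and>
     smooth_map (prod_mfd M M) M (\<lambda>(x, y). x \<otimes>\<^bsub>G\<^esub> y) \<and>
     smooth_map M M (\<lambda>x. inv\<^bsub>G\<^esub> x)"

definition DiffGroup :: "'a::euclidean_space set \<Rightarrow> ('a \<Rightarrow> 'a) monoid" where
  "DiffGroup X = (BijGroup X) \<lparr> carrier := {f \<in> Bij X.
     smooth_map (open_mfd X) (open_mfd X) f \<and>
     smooth_map (open_mfd X) (open_mfd X) (inv_into X f)} \<rparr>"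

definition smooth_action ::
  "('g, 'm) monoid_scheme \<Rightarrow> ('g, 'e::euclidean_space) mfd \<Rightarrow> 'a::euclidean_space set
    \<Rightarrow> ('g \<Rightarrow> 'a \<Rightarrow> 'a) \<Rightarrow> bool" where
  "smooth_action G M X \<alpha> \<longleftrightarrow> \<alpha> \<in> hom G (DiffGroup X) \<and>
     smooth_map (prod_mfd M (open_mfd X)) (open_mfd X) (\<lambda>(g, x). \<alpha> g x)"


section \<open>Measures and transport problems\<close>

abbreviation borel_on :: "'a::topological_space set \<Rightarrow> 'a measure" where
  "borel_on X \<equiv> restrict_space borel X"

definition borel_probs :: "'a::topological_space set \<Rightarrow> 'a measure set" where
  "borel_probs X = {\<mu>. prob_space \<mu> \<and> sets \<mu> = sets (borel_on X)}"

definition push :: "'a::topological_space set \<Rightarrow> ('b \<Rightarrow> 'a) \<Rightarrow> 'b measure \<Rightarrow> 'a measure" where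
  "push X T \<mu> = distr \<mu> (borel_on X) T"

text \<open>
  The integral with values in \<open>[-\<infinity>, \<infinity>]\<close> of a real function.  When positive and negative part
  both have infinite integral, the value is \<open>\<infinity> - \<infinity> = \<infinity>\<close> (the convention of type \<open>ereal\<close>), so that
  competitors with undefined cost play no role in the infima below.
\<close>

definition ext_integral :: "'a measure \<Rightarrow> ('a \<Rightarrow> real) \<Rightarrow> ereal" where
  "ext_integral \<mu> f =
     enn2ereal (\<integral>\<^sup>+x. ennreal (f x) \<partial>\<mu>) - enn2ereal (\<integral>\<^sup>+x. ennreal (- f x) \<partial>\<mu>)"

lemma ext_integral_eq_integral:
  assumes "integrable \<mu> f"
  shows "ext_integral \<mu> f = ereal (integral\<^sup>L \<mu> f)"
proof -
  have "(\<integral>\<^sup>+x. ennreal (f x) \<partial>\<mu>) < \<infinity>" "(\<integral>\<^sup>+x. ennreal (- f x) \<partial>\<mu>) < \<infinity>"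
    using assms unfolding real_integrable_def by (auto simp: top.not_eq_extremum)
  then show ?thesis
    unfolding ext_integral_def real_lebesgue_integral_def[OF assms]
    by (cases "\<integral>\<^sup>+x. ennreal (f x) \<partial>\<mu>"; cases "\<integral>\<^sup>+x. ennreal (- f x) \<partial>\<mu>") auto
qed

definition transport_maps ::
  "'a::topological_space set \<Rightarrow> 'a measure \<Rightarrow> 'a measure \<Rightarrow> ('a \<Rightarrow> 'a) set" where
  "transport_maps X \<mu> \<nu> = {T \<in> borel_on X \<rightarrow>\<^sub>M borel_on X. push X T \<mu> = \<nu>}"

definition transport_plans ::
  "'a::topological_space set \<Rightarrow> 'a measure \<Rightarrow> 'a measure \<Rightarrow> ('a \<times> 'a) measure set" where
  "transport_plans X \<mu> \<nu> = {\<Gamma> \<in> borel_probs (X \<times> X). push X fst \<Gamma> = \<mu> \<and> push X snd \<Gamma> = \<nu>}"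

definition map_cost :: "('a \<Rightarrow> 'a \<Rightarrow> real) \<Rightarrow> 'a measure \<Rightarrow> ('a \<Rightarrow> 'a) \<Rightarrow> ereal" where
  "map_cost c \<mu> T = ext_integral \<mu> (\<lambda>x. c x (T x))"

definition plan_cost :: "('a \<Rightarrow> 'a \<Rightarrow> real) \<Rightarrow> ('a \<times> 'a) measure \<Rightarrow> ereal" where
  "plan_cost c \<Gamma> = ext_integral \<Gamma> (\<lambda>(x, y). c x y)"

definition monge ::
  "'a::topological_space set \<Rightarrow> ('a \<Rightarrow> 'a \<Rightarrow> real) \<Rightarrow> 'a measure \<Rightarrow> 'a measure \<Rightarrow> ereal" where
  "monge X c \<mu> \<nu> = (INF T\<in>transport_maps X \<mu> \<nu>. map_cost c \<mu> T)"

definition kantorovich ::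
  "'a::topological_space set \<Rightarrow> ('a \<Rightarrow> 'a \<Rightarrow> real) \<Rightarrow> 'a measure \<Rightarrow> 'a measure \<Rightarrow> ereal" where
  "kantorovich X c \<mu> \<nu> = (INF \<Gamma>\<in>transport_plans X \<mu> \<nu>. plan_cost c \<Gamma>)"

definition measure_stab ::
  "('g, 'm) monoid_scheme \<Rightarrow> 'a::topological_space set \<Rightarrow> ('g \<Rightarrow> 'a \<Rightarrow> 'a) \<Rightarrow> 'a measure \<Rightarrow> 'g set"
  where "measure_stab G X \<alpha> \<rho> = {h \<in> carrier G. push X (\<alpha> h) \<rho> = \<rho>}"

definition orbit_cost ::
  "('g, 'm) monoid_scheme \<Rightarrow> ('g \<Rightarrow> 'a \<Rightarrow> 'a) \<Rightarrow> 'a measure \<Rightarrow> ('a \<Rightarrow> 'a \<Rightarrow> real)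
    \<Rightarrow> 'g \<Rightarrow> 'g \<Rightarrow> 'g \<Rightarrow> ereal" where
  "orbit_cost G \<alpha> \<rho> c g0 g1 h =
     ext_integral \<rho> (\<lambda>x. c (\<alpha> g0 x) (\<alpha> (g1 \<otimes>\<^bsub>G\<^esub> h) x))"

definition orbit_transport ::
  "('g, 'm) monoid_scheme \<Rightarrow> 'a::topological_space set \<Rightarrow> ('g \<Rightarrow> 'a \<Rightarrow> 'a) \<Rightarrow> 'a measure
    \<Rightarrow> ('a \<Rightarrow> 'a \<Rightarrow> real) \<Rightarrow> 'g \<Rightarrow> 'g \<Rightarrow> ereal" where
  "orbit_transport G X \<alpha> \<rho> c g0 g1 =
     (INF h\<in>measure_stab G X \<alpha> \<rho>. orbit_cost G \<alpha> \<rho> c g0 g1 h)"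


section \<open>Gradients and \<open>c\<close>-convexity\<close>

definition gradient :: "('a::real_inner \<Rightarrow> real) \<Rightarrow> 'a \<Rightarrow> 'a" where
  "gradient f x = (THE D. GDERIV f x :> D)"

text \<open>
  An extended-real function is differentiable at \<open>x\<close> if it is finite near \<open>x\<close> and differentiable
  there as a real function.  It is applied to functions on an open set \<open>X\<close> and to \<open>x \<in> X\<close>, so values
  outside \<open>X\<close> are irrelevant.
\<close>

definition ereal_differentiable_at :: "('a::real_inner \<Rightarrow> ereal) \<Rightarrow> 'a \<Rightarrow> bool" where
  "ereal_differentiable_at \<psi> x \<longleftrightarrow> (\<forall>\<^sub>F z in nhds x. \<bar>\<psi> z\<bar> \<noteq> \<infinity>) \<and>
     (\<lambda>z. real_of_ereal (\<psi> z)) differentiable (at x)"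

definition ereal_gradient :: "('a::real_inner \<Rightarrow> ereal) \<Rightarrow> 'a \<Rightarrow> 'a" where
  "ereal_gradient \<psi> x = gradient (\<lambda>z. real_of_ereal (\<psi> z)) x"

definition c_convex ::
  "'a set \<Rightarrow> ('a \<Rightarrow> 'a \<Rightarrow> real) \<Rightarrow> ('a \<Rightarrow> ereal) \<Rightarrow> bool" where
  "c_convex X c \<psi> \<longleftrightarrow> (\<forall>x\<in>X. \<psi> x \<noteq> -\<infinity>) \<and> (\<exists>x\<in>X. \<psi> x \<noteq> \<infinity>) \<and>
     (\<exists>\<phi> :: 'a \<Rightarrow> ereal. \<forall>x\<in>X. \<psi> x = (SUP y\<in>X. \<phi> y - ereal (c x y)))"

definition c_subdiff :: "'a set \<Rightarrow> ('a \<Rightarrow> 'a \<Rightarrow> real) \<Rightarrow> ('a \<Rightarrow> ereal) \<Rightarrow> 'a \<Rightarrow> 'a set" where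
  "c_subdiff X c \<psi> x = {y \<in> X. \<forall>z\<in>X. \<psi> z \<ge> \<psi> x + ereal (c x y) - ereal (c z y)}"

definition dom_c_subdiff :: "'a set \<Rightarrow> ('a \<Rightarrow> 'a \<Rightarrow> real) \<Rightarrow> ('a \<Rightarrow> ereal) \<Rightarrow> 'a set" where
  "dom_c_subdiff X c \<psi> = {x \<in> X. c_subdiff X c \<psi> x \<noteq> {}}"


section \<open>Assumptions on the cost\<close>

definition C1_on :: "'a::real_inner set \<Rightarrow> ('a \<Rightarrow> real) \<Rightarrow> bool" where
  "C1_on X f \<longleftrightarrow> (\<forall>x\<in>X. f differentiable (at x)) \<and> continuous_on X (gradient f)"

definition assumption_A :: "'a::euclidean_space set \<Rightarrow> ('a \<Rightarrow> 'a \<Rightarrow> real) \<Rightarrow> bool" where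
  "assumption_A X c \<longleftrightarrow>
     continuous_on (X \<times> X) (\<lambda>(x, y). c x y) \<and>
     (\<exists>b. \<forall>x\<in>X. \<forall>y\<in>X. b \<le> c x y) \<and>
     (\<forall>y\<in>X. C1_on X (\<lambda>x. c x y)) \<and>
     (\<forall>x\<in>X. inj_on (\<lambda>y. gradient (\<lambda>z. c z y) x) X)"

definition assumption_B ::
  "'a::euclidean_space set \<Rightarrow> ('a \<Rightarrow> 'a \<Rightarrow> real) \<Rightarrow> 'a measure \<Rightarrow> bool" where
  "assumption_B X c \<mu> \<longleftrightarrow> (\<forall>\<psi>. c_convex X c \<psi> \<longrightarrow>
     (AE x in \<mu>. x \<in> dom_c_subdiff X c \<psi> \<longrightarrow> ereal_differentiable_at \<psi> x))"

text \<open>For \<open>x\<close> outside the closure of \<open>S\<close> the following set is empty.\<close>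

definition tangent_cone :: "'a::real_normed_vector set \<Rightarrow> 'a \<Rightarrow> 'a set" where
  "tangent_cone S x = {v. \<exists>(s :: nat \<Rightarrow> 'a) (t :: nat \<Rightarrow> real).
     (\<forall>k. s k \<in> S) \<and> s \<longlonglongrightarrow> x \<and> (\<forall>k. t k > 0) \<and> t \<longlonglongrightarrow> 0 \<and>
     (\<lambda>k. (s k - x) /\<^sub>R t k) \<longlonglongrightarrow> v}"

text \<open>The filter of points \<open>y \<in> X\<close> that leave every compact subset of \<open>X\<close>.\<close>

definition leaving_compacts :: "'a::topological_space set \<Rightarrow> 'a filter" where
  "leaving_compacts X = (INF K\<in>{K. compact K \<and> K \<subseteq> X}. principal (X - K))"

lemma eventually_leaving_compacts:
  "eventually P (leaving_compacts X) \<longleftrightarrow> (\<exists>K. compact K \<and> K \<subseteq> X \<and> (\<forall>y\<in>X - K. P y))"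
proof -
  have "eventually P (leaving_compacts X) \<longleftrightarrow>
      (\<exists>K\<in>{K. compact K \<and> K \<subseteq> X}. eventually P (principal (X - K)))"
    unfolding leaving_compacts_def
  proof (rule eventually_INF_base)
    show "{K. compact K \<and> K \<subseteq> X} \<noteq> {}" by blast
    fix K L assume "K \<in> {K. compact K \<and> K \<subseteq> X}" "L \<in> {K. compact K \<and> K \<subseteq> X}"
    then show "\<exists>J\<in>{K. compact K \<and> K \<subseteq> X}.
        principal (X - J) \<le> inf (principal (X - K)) (principal (X - L))"
      by (intro bexI[of _ "K \<union> L"]) auto
  qed
  then show ?thesis by (auto simp: eventually_principal)
qed

text \<open>
  Half-spaces are closed and may be affine; for a cone, containment in such a half-space is the same
  as containment in one bounded by a hyperplane through the origin.
\<close>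

definition assumption_C :: "'a::euclidean_space set \<Rightarrow> ('a \<Rightarrow> 'a \<Rightarrow> real) \<Rightarrow> bool" where
  "assumption_C X c \<longleftrightarrow>
     (\<forall>x\<in>X. \<forall>S\<in>sets borel. S \<subseteq> X \<and> \<not> (\<exists>a b. a \<noteq> 0 \<and> tangent_cone S x \<subseteq> {v. a \<bullet> v \<le> b}) \<longrightarrow>
        (\<exists>Z p r. finite Z \<and> Z \<noteq> {} \<and> Z \<subseteq> S \<and> x \<in> ball p r \<and> ball p r \<subseteq> X \<and>
           (\<forall>\<^sub>F y in leaving_compacts X.
              (INF w\<in>ball p r. ereal (c w y)) \<ge> (INF z\<in>Z. ereal (c z y))))) \<and>
     (\<forall>x\<in>X. \<forall>U. U \<subseteq> X \<and> x \<in> interior U \<longrightarrow>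
        (\<exists>p r. x \<in> ball p r \<and> ball p r \<subseteq> X \<and>
           ((\<lambda>y. SUP w\<in>ball p r. INF z\<in>U. ereal (c z y - c w y)) \<longlongrightarrow> -\<infinity>) (leaving_compacts X)))"

end

theory Submission
  imports Defs
begin

text \<open>
  The stabilizer element \<open>h\<close> enters only through the map \<open>T = \<alpha>(g1 h g0\<^sup>-\<^sup>1)\<close>: since
  \<open>T \<circ> \<alpha>(g0) = \<alpha>(g1 h)\<close> and \<open>\<alpha>(h)\<close> preserves \<open>\<rho>\<close>, the map \<open>T\<close> transports \<open>\<mu>0\<close> to \<open>\<mu>1\<close>, and the change
  of variables \<open>\<alpha>(g0)\<close> turns its Monge cost into the orbit cost of \<open>h\<close>
  (\<open>stabilizer_transport_map\<close>).  So the orbit problem is a Monge problem with fewer competitors,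
  which is (i), and the graph of a map is a plan, so that \<open>K \<le> M \<le> J\<close>.  For (ii) it is enough
  to show that \<open>T\<close> costs no more than any plan, and that a plan of the same finite cost lives on the
  graph of \<open>T\<close>: then \<open>J \<le> cost of h = cost of T \<le> K\<close> closes the chain, and a plan
  living on the graph of \<open>T\<close> is determined by its first marginal.

  Optimality comes from Kantorovich duality.  Let \<open>\<psi>\<close> be the given potential and
  \<open>\<psi>'(y) = inf\<^sub>z \<psi>(z) + c(z, y)\<close> its conjugate, so that \<open>\<psi>'(y) - \<psi>(x) \<le> c(x, y)\<close> wherever
  \<open>\<psi>(x)\<close> is finite, with equality exactly when \<open>y \<in> \<partial>\<^sup>c\<psi>(x)\<close>.  At a point \<open>x\<close> where \<open>\<psi>\<close> is differentiable every
  \<open>y \<in> \<partial>\<^sup>c\<psi>(x)\<close> solves \<open>\<nabla>\<psi>(x) + \<nabla>\<^sub>xc(x, y) = 0\<close>, because \<open>\<psi> + c(\<cdot>, y)\<close> is minimal at \<open>x\<close>; by the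
  twist condition this equation has at most one solution, and \<open>T(x)\<close> is one.  Hence
  \<open>\<partial>\<^sup>c\<psi>(x) = {T(x)}\<close> as soon as \<open>\<partial>\<^sup>c\<psi>(x)\<close> is nonempty (\<open>c_subdiff_eq_singleton\<close>).

  Nonemptiness is where the growth condition \<open>(H\<^sub>\<infinity>)\<close> enters (\<open>c_subdiff_nonempty\<close>).  Write \<open>\<psi>\<close> as a
  supremum of functions \<open>\<zeta>(y) - c(\<cdot>, y)\<close>.  If almost maximizing points \<open>y\<close> at \<open>x\<close> left every compact
  set, then for a point \<open>z\<close> near \<open>x\<close> the value \<open>c(z, y)\<close> would lie far below \<open>c(x, y)\<close>, so that \<open>\<psi>(z)\<close>
  would be much larger than \<open>\<psi>(x)\<close>, against the continuity of \<open>\<psi>\<close> at \<open>x\<close>.  Thus maximizing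
  sequences stay in a compact set, and any limit point is a subgradient.

  It remains to integrate \<open>\<psi>'(y) - \<psi>(x) \<le> c(x, y)\<close> against a plan and the corresponding equality
  along \<open>T\<close>.  The potentials need not be integrable; the lemma \<open>duality_gap_le\<close> truncates them, uses
  that the integral of the truncated difference depends on the marginals only, and passes to
  the limit by Fatou's lemma on both sides at once.  Its conclusion bounds the sum of the integrated
  duality gap of the plan and the cost of \<open>T\<close> by the cost of the plan.  This gives optimality, and
  if the costs agree and are finite, the gap vanishes almost everywhere, which places the plan on
  the graph of \<open>T\<close>.
\<close>

section \<open>Extended integrals\<close>

lemma ext_integral_distr:
  assumes "f \<in> measurable M N" and "k \<in> borel_measurable N"
  shows "ext_integral (distr M N f) k = ext_integral M (\<lambda>x. k (f x))"
  unfolding ext_integral_def using assms by (subst (1 2) nn_integral_distr) auto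

lemma ext_integral_cong:
  assumes "\<And>x. x \<in> space M \<Longrightarrow> f x = g x"
  shows "ext_integral M f = ext_integral M g"
proof -
  have "(\<integral>\<^sup>+x. ennreal (f x) \<partial>M) = (\<integral>\<^sup>+x. ennreal (g x) \<partial>M)"
    and "(\<integral>\<^sup>+x. ennreal (- f x) \<partial>M) = (\<integral>\<^sup>+x. ennreal (- g x) \<partial>M)"
    using assms by (auto intro!: nn_integral_cong)
  then show ?thesis by (simp add: ext_integral_def)
qed

text \<open>
  A function bounded below on a probability space has no \<open>\<infinity> - \<infinity>\<close> problem, so costs can be
  compared through nonnegative integrals of \<open>f - b\<close>.
\<close>

lemma ext_integral_bounded_below:
  assumes "prob_space M" and f[measurable]: "f \<in> borel_measurable M"
    and ge: "\<And>x. x \<in> space M \<Longrightarrow> b \<le> f x"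
  shows "ext_integral M f = enn2ereal (\<integral>\<^sup>+x. ennreal (f x - b) \<partial>M) + ereal b"
proof -
  interpret prob_space M by fact
  show ?thesis
  proof (cases "(\<integral>\<^sup>+x. ennreal (f x - b) \<partial>M) = \<infinity>")
    case False
    have int: "integrable M (\<lambda>x. f x - b)"
      using False ge by (intro integrableI_nonneg) (auto simp: top.not_eq_extremum)
    then have "integrable M (\<lambda>x. (f x - b) + b)"
      by (intro Bochner_Integration.integrable_add) auto
    then have int': "integrable M f" by simp
    have "(\<integral>\<^sup>+x. ennreal (f x - b) \<partial>M) = ennreal (\<integral>x. f x - b \<partial>M)"
      using int ge by (intro nn_integral_eq_integral) auto
    moreover have "0 \<le> (\<integral>x. f x - b \<partial>M)"
      using ge by (intro integral_nonneg_AE) auto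
    moreover have "(\<integral>x. f x - b \<partial>M) = (\<integral>x. f x \<partial>M) - b"
      using int' by (simp add: prob_space)
    ultimately show ?thesis
      using ext_integral_eq_integral[OF int'] by (simp add: enn2ereal_ennreal)
  next
    case True
    have "- f x \<le> \<bar>b\<bar>" if "x \<in> space M" for x
      using ge[OF that] by linarith
    then have "(\<integral>\<^sup>+x. ennreal (- f x) \<partial>M) \<le> (\<integral>\<^sup>+x. ennreal \<bar>b\<bar> \<partial>M)"
      by (intro nn_integral_mono ennreal_leI)
    also have "\<dots> < \<infinity>" by (simp add: emeasure_space_1)
    finally have neg: "(\<integral>\<^sup>+x. ennreal (- f x) \<partial>M) < \<infinity>" .
    have "\<infinity> = (\<integral>\<^sup>+x. ennreal (f x - b) \<partial>M)" using True by simp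
    also have "\<dots> \<le> (\<integral>\<^sup>+x. ennreal (f x) + ennreal \<bar>b\<bar> \<partial>M)"
    proof (intro nn_integral_mono)
      fix x
      have "ennreal (f x - b) \<le> ennreal (max 0 (f x) + \<bar>b\<bar>)" by (intro ennreal_leI) auto
      also have "\<dots> = ennreal (f x) + ennreal \<bar>b\<bar>" by (simp add: ennreal_plus max_def ennreal_neg)
      finally show "ennreal (f x - b) \<le> ennreal (f x) + ennreal \<bar>b\<bar>" .
    qed
    also have "\<dots> = (\<integral>\<^sup>+x. ennreal (f x) \<partial>M) + ennreal \<bar>b\<bar>"
      by (subst nn_integral_add) (auto simp: emeasure_space_1)
    finally have "(\<integral>\<^sup>+x. ennreal (f x) \<partial>M) = \<infinity>"
      by (simp add: top_unique)
    with neg show ?thesis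
      unfolding ext_integral_def True
      by (cases "\<integral>\<^sup>+x. ennreal (- f x) \<partial>M") (simp_all add: enn2ereal_ennreal)
  qed
qed


section \<open>The duality gap of a pair of potentials\<close>

lemma liminf_ennreal_add_le:
  fixes f g :: "nat \<Rightarrow> ennreal"
  assumes "\<And>n. f n + g n \<le> C"
  shows "liminf f + liminf g \<le> C"
proof -
  have "incseq (\<lambda>n. INF m\<in>{n..}. f m)" "incseq (\<lambda>n. INF m\<in>{n..}. g m)"
    by (auto simp: incseq_def intro!: INF_superset_mono)
  then have "liminf f + liminf g = (SUP n. (INF m\<in>{n..}. f m) + (INF m\<in>{n..}. g m))"
    unfolding liminf_SUP_INF by (rule ennreal_SUP_add[symmetric])
  also have "\<dots> \<le> C"
  proof (rule SUP_least)
    fix n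
    have "(INF m\<in>{n..}. f m) + (INF m\<in>{n..}. g m) \<le> f n + g n"
      by (intro add_mono INF_lower) auto
    then show "(INF m\<in>{n..}. f m) + (INF m\<in>{n..}. g m) \<le> C" using assms order_trans by blast
  qed
  finally show ?thesis .
qed

text \<open>
  Formally the integral of \<open>v \<circ> q - u \<circ> p\<close> over \<open>P\<close> equals that of \<open>v \<circ> T - u\<close> over \<open>M\<close>, since both
  see only the same marginals; then the claim would be an equality.  As \<open>u\<close> and \<open>v\<close> may fail to be
  integrable, both are truncated to \<open>[-n, n]\<close>.  Truncation is monotone and contracts distances,
  so the truncated difference stays below \<open>max 0 (v - u) \<le> k\<close>, and it is nonnegative
  where \<open>v - u\<close> is.  For the two integrals taken together only the inequality survives the limit,
  but this is the direction that bounds the duality gap of a plan.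
\<close>

lemma duality_gap_le:
  fixes u :: "'a \<Rightarrow> real" and v :: "'b \<Rightarrow> real" and k :: "'c \<Rightarrow> real"
  assumes P: "prob_space P"
    and p[measurable]: "p \<in> measurable P M" and q[measurable]: "q \<in> measurable P N"
    and T[measurable]: "T \<in> measurable M N"
    and fst: "distr P M p = M" and snd: "distr P N q = distr M N T"
    and u[measurable]: "u \<in> borel_measurable M" and v[measurable]: "v \<in> borel_measurable N"
    and k[measurable]: "k \<in> borel_measurable P"
    and k_nonneg: "AE w in P. 0 \<le> k w"
    and gap: "AE w in P. v (q w) - u (p w) \<le> k w"
    and match: "AE x in M. 0 \<le> v (T x) - u x"
  shows "(\<integral>\<^sup>+w. ennreal (k w - (v (q w) - u (p w))) \<partial>P) + (\<integral>\<^sup>+x. ennreal (v (T x) - u x) \<partial>M)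
    \<le> (\<integral>\<^sup>+w. ennreal (k w) \<partial>P)"
proof (cases "(\<integral>\<^sup>+w. ennreal (k w) \<partial>P) = \<infinity>")
  case False
  interpret P: prob_space P by fact
  interpret M: prob_space M using P.prob_space_distr[OF p] fst by simp
  define cl :: "nat \<Rightarrow> real \<Rightarrow> real" where "cl n t = max (- real n) (min (real n) t)" for n t
  have cl_bound: "\<bar>cl n t\<bar> \<le> real n" for n t by (auto simp: cl_def)
  have cl_meas[measurable]: "cl n \<in> borel_measurable borel" for n unfolding cl_def by measurable
  have cl_tendsto: "(\<lambda>n. cl n t) \<longlonglongrightarrow> t" for t
  proof (rule tendsto_eventually)
    obtain m :: nat where "\<bar>t\<bar> \<le> real m" using real_arch_simple by blast
    then show "\<forall>\<^sub>F n in sequentially. cl n t = t"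
      unfolding eventually_sequentially by (intro exI[of _ m]) (auto simp: cl_def)
  qed
  have k_int: "integrable P k"
    using False k_nonneg by (intro integrableI_nonneg) (auto simp: top.not_eq_extremum)
  have int_P: "integrable P (\<lambda>w. cl n (v (q w)))" "integrable P (\<lambda>w. cl n (u (p w)))" for n
    using cl_bound by (auto intro!: P.integrable_const_bound[where B = "real n"])
  have int_M: "integrable M (\<lambda>x. cl n (v (T x)))" "integrable M (\<lambda>x. cl n (u x))" for n
    using cl_bound by (auto intro!: M.integrable_const_bound[where B = "real n"])
  define I where "I n = (\<integral>x. cl n (v (T x)) - cl n (u x) \<partial>M)" for n
  have I_P: "(\<integral>w. cl n (v (q w)) - cl n (u (p w)) \<partial>P) = I n" for n
  proof -
    have "(\<integral>w. cl n (v (q w)) \<partial>P) = (\<integral>y. cl n (v y) \<partial>distr P N q)"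
      by (subst integral_distr) auto
    also have "\<dots> = (\<integral>x. cl n (v (T x)) \<partial>M)"
      unfolding snd by (subst integral_distr) auto
    finally have v_eq: "(\<integral>w. cl n (v (q w)) \<partial>P) = (\<integral>x. cl n (v (T x)) \<partial>M)" .
    have "(\<integral>w. cl n (u (p w)) \<partial>P) = (\<integral>x. cl n (u x) \<partial>distr P M p)"
      by (subst integral_distr) auto
    then have "(\<integral>w. cl n (u (p w)) \<partial>P) = (\<integral>x. cl n (u x) \<partial>M)" by (simp add: fst)
    with v_eq show ?thesis using int_P int_M by (simp add: I_def)
  qed
  \<comment> \<open>The two integrals exchange exactly the amount \<open>I n\<close>, so their sum does not depend on \<open>n\<close>.\<close>
  let ?A = "\<lambda>n. \<integral>\<^sup>+w. ennreal (k w - (cl n (v (q w)) - cl n (u (p w)))) \<partial>P"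
  let ?B = "\<lambda>n. \<integral>\<^sup>+x. ennreal (cl n (v (T x)) - cl n (u x)) \<partial>M"
  have "?A n + ?B n \<le> (\<integral>\<^sup>+w. ennreal (k w) \<partial>P)" for n
  proof -
    have nonneg_P: "AE w in P. 0 \<le> k w - (cl n (v (q w)) - cl n (u (p w)))"
      using k_nonneg gap by eventually_elim (auto simp: cl_def)
    have nonneg_M: "AE x in M. 0 \<le> cl n (v (T x)) - cl n (u x)"
      using match by eventually_elim (auto simp: cl_def)
    have "?A n = ennreal (\<integral>w. k w - (cl n (v (q w)) - cl n (u (p w))) \<partial>P)"
      using nonneg_P int_P k_int by (intro nn_integral_eq_integral) auto
    moreover have "(\<integral>w. k w - (cl n (v (q w)) - cl n (u (p w))) \<partial>P) = (\<integral>w. k w \<partial>P) - I n"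
      using int_P k_int by (subst Bochner_Integration.integral_diff) (auto simp: I_P)
    moreover have "0 \<le> (\<integral>w. k w - (cl n (v (q w)) - cl n (u (p w))) \<partial>P)"
      using nonneg_P by (rule integral_nonneg_AE)
    moreover have "?B n = ennreal (I n)"
      unfolding I_def using nonneg_M int_M by (intro nn_integral_eq_integral) auto
    moreover have "0 \<le> I n" unfolding I_def using nonneg_M by (rule integral_nonneg_AE)
    moreover have "(\<integral>\<^sup>+w. ennreal (k w) \<partial>P) = ennreal (\<integral>w. k w \<partial>P)"
      using k_nonneg k_int by (intro nn_integral_eq_integral) auto
    ultimately show ?thesis by (simp flip: ennreal_plus)
  qed
  then have "liminf ?A + liminf ?B \<le> (\<integral>\<^sup>+w. ennreal (k w) \<partial>P)" by (rule liminf_ennreal_add_le)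
  moreover have "(\<integral>\<^sup>+w. ennreal (k w - (v (q w) - u (p w))) \<partial>P) \<le> liminf ?A"
  proof -
    have "liminf (\<lambda>n. ennreal (k w - (cl n (v (q w)) - cl n (u (p w)))))
        = ennreal (k w - (v (q w) - u (p w)))" for w
      by (intro lim_imp_Liminf tendsto_ennrealI tendsto_intros cl_tendsto) simp
    then show ?thesis
      using nn_integral_liminf[of "\<lambda>n w. ennreal (k w - (cl n (v (q w)) - cl n (u (p w))))" P]
      by simp
  qed
  moreover have "(\<integral>\<^sup>+x. ennreal (v (T x) - u x) \<partial>M) \<le> liminf ?B"
  proof -
    have "liminf (\<lambda>n. ennreal (cl n (v (T x)) - cl n (u x))) = ennreal (v (T x) - u x)" for x
      by (intro lim_imp_Liminf tendsto_ennrealI tendsto_intros cl_tendsto) simp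
    then show ?thesis
      using nn_integral_liminf[of "\<lambda>n x. ennreal (cl n (v (T x)) - cl n (u x))" M] by simp
  qed
  ultimately show ?thesis by (meson add_mono order_trans)
qed simp


section \<open>Gradients of potentials and \<open>c\<close>-subdifferentials\<close>

lemma GDERIV_unique:
  assumes "GDERIV f x :> D" and "GDERIV f x :> E"
  shows "D = E"
proof -
  have "(\<lambda>h. h \<bullet> D) = (\<lambda>h. h \<bullet> E)"
    using assms unfolding gderiv_def by (rule has_derivative_unique)
  then have "(D - E) \<bullet> (D - E) = 0" by (metis inner_diff_right right_minus_eq)
  then show ?thesis by simp
qed

lemma differentiable_GDERIV:
  fixes f :: "'a::euclidean_space \<Rightarrow> real"
  assumes "f differentiable (at x)"
  shows "GDERIV f x :> gradient f x"
proof -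
  obtain f' where f': "(f has_derivative f') (at x)" using assms by (auto simp: differentiable_def)
  then interpret bounded_linear f' by (rule has_derivative_bounded_linear)
  define D where "D = (\<Sum>b\<in>Basis. f' b *\<^sub>R b)"
  have "f' = (\<lambda>h. h \<bullet> D)"
  proof
    fix h
    have "f' h = f' (\<Sum>b\<in>Basis. (h \<bullet> b) *\<^sub>R b)" by (simp add: euclidean_representation)
    also have "\<dots> = (\<Sum>b\<in>Basis. (h \<bullet> b) * f' b)" by (simp add: sum scaleR)
    also have "\<dots> = h \<bullet> D" by (simp add: D_def inner_sum_right mult.commute)
    finally show "f' h = h \<bullet> D" .
  qed
  with f' have "GDERIV f x :> D" unfolding gderiv_def by (rule back_subst)
  then show ?thesis unfolding gradient_def by (metis GDERIV_unique theI)
qed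

text \<open>First-order condition: \<open>z \<mapsto> \<psi>(z) + c(z, y)\<close> has a minimum at \<open>x\<close>.\<close>

lemma c_subdiff_gradient:
  fixes X :: "'a::euclidean_space set"
  assumes X: "open X" "x \<in> X" and y: "y \<in> c_subdiff X c \<psi> x"
    and \<psi>: "ereal_differentiable_at \<psi> x" and c: "(\<lambda>z. c z y) differentiable (at x)"
  shows "ereal_gradient \<psi> x + gradient (\<lambda>z. c z y) x = 0"
proof -
  let ?f = "\<lambda>z. real_of_ereal (\<psi> z)"
  obtain S where S: "open S" "x \<in> S" "\<And>z. z \<in> S \<Longrightarrow> \<bar>\<psi> z\<bar> \<noteq> \<infinity>"
    using \<psi> unfolding ereal_differentiable_at_def eventually_nhds by metis
  have min: "?f x + c x y \<le> ?f z + c z y" if "z \<in> S \<inter> X" for z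
  proof -
    have "\<psi> z \<ge> \<psi> x + ereal (c x y) - ereal (c z y)"
      using y that unfolding c_subdiff_def by blast
    then show ?thesis
      using S(3)[of x] S(3)[of z] S(2) that by (cases "\<psi> x"; cases "\<psi> z") auto
  qed
  have "GDERIV (\<lambda>z. ?f z + c z y) x :> ereal_gradient \<psi> x + gradient (\<lambda>z. c z y) x"
    using \<psi> c unfolding ereal_gradient_def ereal_differentiable_at_def
    by (intro GDERIV_add differentiable_GDERIV) auto
  then have "(\<lambda>h. h \<bullet> (ereal_gradient \<psi> x + gradient (\<lambda>z. c z y) x)) = (\<lambda>h. 0)"
    unfolding gderiv_def
    using S X min by (intro differential_zero_maxmin[of x "S \<inter> X"]) auto
  then show ?thesis by (metis inner_eq_zero_iff)
qed

lemma continuous_on_sections: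
  assumes "continuous_on (X \<times> Y) (\<lambda>(x, y). c x y)"
  shows "y \<in> Y \<Longrightarrow> continuous_on X (\<lambda>x. c x y)" and "x \<in> X \<Longrightarrow> continuous_on Y (\<lambda>y. c x y)"
proof -
  assume "y \<in> Y"
  then have "continuous_on X (\<lambda>x. case (x, y) of (x, y) \<Rightarrow> c x y)"
    by (intro continuous_on_compose2[OF assms] continuous_intros) auto
  then show "continuous_on X (\<lambda>x. c x y)" by simp
next
  assume "x \<in> X"
  then have "continuous_on Y (\<lambda>y. case (x, y) of (x, y) \<Rightarrow> c x y)"
    by (intro continuous_on_compose2[OF assms] continuous_intros) auto
  then show "continuous_on Y (\<lambda>y. c x y)" by simp
qed

text \<open>
  Points \<open>y\<close> near infinity are useless for the supremum defining \<open>\<psi>(x)\<close>.  By continuity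
  \<open>\<psi> < \<psi>(x) + 1\<close> on a neighbourhood \<open>U\<close> of \<open>x\<close>, while the second part of \<open>(H\<^sub>\<infinity>)\<close> provides, for
  \<open>y\<close> outside a compact set, some \<open>z \<in> U\<close> with \<open>c(z, y) < c(x, y) - 2\<close>.  Then
  \<open>\<zeta>(y) - c(x, y) \<le> \<zeta>(y) - c(z, y) - 2 \<le> \<psi>(z) - 2 \<le> \<psi>(x) - 1\<close>.
\<close>

lemma c_convex_bounded_away_from_compact:
  fixes X :: "'a::euclidean_space set"
  assumes C: "assumption_C X c" and X: "open X" "x \<in> X"
    and \<psi>: "ereal_differentiable_at \<psi> x"
    and sup: "\<And>z. z \<in> X \<Longrightarrow> \<psi> z = (SUP y\<in>X. \<zeta> y - ereal (c z y))"
  obtains K where "compact K" "K \<subseteq> X"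
    "\<And>y. y \<in> X - K \<Longrightarrow> \<zeta> y - ereal (c x y) \<le> \<psi> x - 1"
proof -
  let ?f = "\<lambda>z. real_of_ereal (\<psi> z)"
  have "isCont ?f x"
    using \<psi> by (auto simp: ereal_differentiable_at_def intro: differentiable_imp_continuous_within)
  then have "\<forall>\<^sub>F z in nhds x. ?f z < ?f x + 1"
    unfolding isCont_def tendsto_at_iff_tendsto_nhds[of ?f x] by (rule order_tendstoD) simp
  moreover have "\<forall>\<^sub>F z in nhds x. z \<in> X" using X by (rule eventually_nhds_in_open)
  moreover have "\<forall>\<^sub>F z in nhds x. \<bar>\<psi> z\<bar> \<noteq> \<infinity>"
    using \<psi> by (simp add: ereal_differentiable_at_def)
  ultimately have "\<forall>\<^sub>F z in nhds x. z \<in> X \<and> \<bar>\<psi> z\<bar> \<noteq> \<infinity> \<and> ?f z < ?f x + 1" by eventually_elim auto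
  then obtain U where U: "open U" "x \<in> U"
    "\<And>z. z \<in> U \<Longrightarrow> z \<in> X \<and> \<bar>\<psi> z\<bar> \<noteq> \<infinity> \<and> ?f z < ?f x + 1"
    unfolding eventually_nhds by metis
  then have "U \<subseteq> X \<and> x \<in> interior U" by (auto simp: interior_open)
  then have "\<exists>p r. x \<in> ball p r \<and> ball p r \<subseteq> X \<and>
      ((\<lambda>y. SUP w\<in>ball p r. INF z\<in>U. ereal (c z y - c w y)) \<longlongrightarrow> -\<infinity>) (leaving_compacts X)"
    using C[unfolded assumption_C_def, THEN conjunct2] X(2) by simp
  then obtain p r where B: "x \<in> ball p r"
    and lim: "((\<lambda>y. SUP w\<in>ball p r. INF z\<in>U. ereal (c z y - c w y)) \<longlongrightarrow> -\<infinity>) (leaving_compacts X)"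
    by (elim exE conjE)
  have "\<forall>\<^sub>F y in leaving_compacts X.
      (SUP w\<in>ball p r. INF z\<in>U. ereal (c z y - c w y)) < ereal (- 2)"
    using lim unfolding tendsto_MInfty by (rule spec)
  then obtain K where K: "compact K" "K \<subseteq> X"
    "\<forall>y\<in>X - K. (SUP w\<in>ball p r. INF z\<in>U. ereal (c z y - c w y)) < ereal (- 2)"
    unfolding eventually_leaving_compacts by (elim exE conjE)
  show thesis
  proof (rule that[OF K(1,2)])
    fix y assume y: "y \<in> X - K"
    have "(INF z\<in>U. ereal (c z y - c x y)) \<le> (SUP w\<in>ball p r. INF z\<in>U. ereal (c z y - c w y))"
      using B by (intro SUP_upper)
    also have "\<dots> < ereal (- 2)" using K(3) y by (rule bspec)
    finally obtain z where z: "z \<in> U" "c z y - c x y < - 2" by (auto simp: INF_less_iff)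
    have "\<psi> z \<ge> \<zeta> y - ereal (c z y)"
      unfolding sup[OF U(3)[OF z(1), THEN conjunct1]] using y by (intro SUP_upper) auto
    then show "\<zeta> y - ereal (c x y) \<le> \<psi> x - 1"
      using z U(3)[OF z(1)] U(3)[OF U(2)]
      by (cases "\<zeta> y"; cases "\<psi> z"; cases "\<psi> x") (auto simp: one_ereal_def)
  qed
qed

text \<open>
  A maximizing sequence for \<open>\<psi>(x) = sup\<^sub>y \<zeta>(y) - c(x, y)\<close> stays in a compact set, and each of its
  limit points is a subgradient.  As \<open>\<zeta>\<close> is an arbitrary function, \<open>\<zeta>(y\<^sub>n)\<close> is eliminated between
  its lower bound from \<open>x\<close> and its upper bound from \<open>z\<close>, which leaves an inequality between
  continuous functions of \<open>y\<^sub>n\<close>, before the limit is taken.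
\<close>

lemma c_subdiff_nonempty:
  fixes X :: "'a::euclidean_space set"
  assumes cont: "continuous_on (X \<times> X) (\<lambda>(x, y). c x y)" and C: "assumption_C X c"
    and X: "open X" "x \<in> X" and conv: "c_convex X c \<psi>" and \<psi>: "ereal_differentiable_at \<psi> x"
  shows "c_subdiff X c \<psi> x \<noteq> {}"
proof -
  obtain \<zeta> :: "'a \<Rightarrow> ereal" where sup: "\<And>z. z \<in> X \<Longrightarrow> \<psi> z = (SUP y\<in>X. \<zeta> y - ereal (c z y))"
    using conv unfolding c_convex_def by blast
  obtain K where K: "compact K" "K \<subseteq> X"
    "\<And>y. y \<in> X - K \<Longrightarrow> \<zeta> y - ereal (c x y) \<le> \<psi> x - 1"
    using c_convex_bounded_away_from_compact[OF C X \<psi> sup] by blast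
  have "\<bar>\<psi> x\<bar> \<noteq> \<infinity>"
    using \<psi> unfolding ereal_differentiable_at_def by (auto dest: eventually_nhds_x_imp_x)
  then obtain a where a: "\<psi> x = ereal a" by (cases "\<psi> x") auto
  \<comment> \<open>Outside \<open>K\<close> the values stay below \<open>a - 1\<close>, and \<open>1 / Suc n \<le> 1\<close>.\<close>
  have "\<exists>y\<in>K. ereal (a - 1 / real (Suc n)) < \<zeta> y - ereal (c x y)" for n
  proof -
    have "ereal (a - 1 / real (Suc n)) < (SUP y\<in>X. \<zeta> y - ereal (c x y))"
      unfolding sup[OF X(2), symmetric] a by simp
    then obtain y where y: "y \<in> X" "ereal (a - 1 / real (Suc n)) < \<zeta> y - ereal (c x y)"
      by (auto simp: less_SUP_iff)
    have "y \<in> K"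
    proof (rule ccontr)
      assume "y \<notin> K"
      then have "\<zeta> y - ereal (c x y) \<le> ereal (a - 1)" using K(3) y a by (simp add: one_ereal_def)
      with y(2) have "ereal (a - 1 / real (Suc n)) < ereal (a - 1)" by (rule less_le_trans)
      then show False by (simp add: field_simps)
    qed
    with y show ?thesis by blast
  qed
  then obtain s where s: "\<And>n. s n \<in> K"
    "\<And>n. ereal (a - 1 / real (Suc n)) < \<zeta> (s n) - ereal (c x (s n))" by metis
  obtain y r where y: "y \<in> K" "strict_mono r" "(s \<circ> r) \<longlonglongrightarrow> y"
    using K(1) s(1) unfolding compact_def by metis
  have lim: "(\<lambda>n. c z (s (r n))) \<longlonglongrightarrow> c z y" if "z \<in> X" for z
  proof -
    have "continuous_on X (c z)"
      using continuous_on_sections(2)[OF cont] that by simp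
    moreover have "y \<in> X" "\<forall>n. s (r n) \<in> X" using y(1) s(1) K(2) by auto
    ultimately show ?thesis
      using continuous_on_tendsto_compose[of X "c z" "s \<circ> r" y] y(3) by simp
  qed
  have "\<psi> z \<ge> \<psi> x + ereal (c x y) - ereal (c z y)" if z: "z \<in> X" for z
  proof (cases "\<psi> z")
    case MInf
    then show ?thesis using conv z by (simp add: c_convex_def)
  next
    case (real e)
    have le: "a - 1 / real (Suc (r n)) + c x (s (r n)) - c z (s (r n)) \<le> e" for n
    proof -
      have "\<zeta> (s (r n)) - ereal (c z (s (r n))) \<le> \<psi> z"
        unfolding sup[OF z] using s(1) K(2) by (intro SUP_upper) auto
      then show ?thesis
        using s(2)[of "r n"] real by (cases "\<zeta> (s (r n))") auto
    qed
    have "(\<lambda>n. 1 / real (Suc (r n))) \<longlonglongrightarrow> 0"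
      using LIMSEQ_subseq_LIMSEQ[OF LIMSEQ_inverse_real_of_nat y(2)]
      by (simp add: comp_def inverse_eq_divide)
    then have "(\<lambda>n. a - 1 / real (Suc (r n)) + c x (s (r n)) - c z (s (r n)))
        \<longlonglongrightarrow> a - 0 + c x y - c z y"
      using z X by (intro tendsto_intros lim) auto
    then have "a - 0 + c x y - c z y \<le> e" using le by (intro LIMSEQ_le_const2) auto
    then show ?thesis using a real by simp
  qed simp
  then show ?thesis using y K by (auto simp: c_subdiff_def)
qed

text \<open>
  The equation for \<open>t\<close> is satisfied by every subgradient, the twist condition makes its solution
  unique, and a subgradient exists.
\<close>

lemma c_subdiff_eq_singleton:
  fixes X :: "'a::euclidean_space set"
  assumes A: "assumption_A X c" and C: "assumption_C X c" and X: "open X" "x \<in> X"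
    and conv: "c_convex X c \<psi>" and \<psi>: "ereal_differentiable_at \<psi> x"
    and t: "t \<in> X" "ereal_gradient \<psi> x + gradient (\<lambda>z. c z t) x = 0"
  shows "c_subdiff X c \<psi> x = {t}"
proof -
  have "y = t" if y: "y \<in> c_subdiff X c \<psi> x" for y
  proof -
    have "y \<in> X" using y by (simp add: c_subdiff_def)
    then have "(\<lambda>z. c z y) differentiable (at x)"
      using A X by (auto simp: assumption_A_def C1_on_def)
    then have "ereal_gradient \<psi> x + gradient (\<lambda>z. c z y) x = 0"
      using c_subdiff_gradient X y \<psi> by blast
    with t have "gradient (\<lambda>z. c z y) x = gradient (\<lambda>z. c z t) x" by (metis add_left_cancel)
    with A X \<open>y \<in> X\<close> t show ?thesis by (auto simp: assumption_A_def dest: inj_onD)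
  qed
  moreover have "c_subdiff X c \<psi> x \<noteq> {}"
    using c_subdiff_nonempty A C X conv \<psi> by (auto simp: assumption_A_def)
  ultimately show ?thesis by blast
qed


section \<open>The conjugate potential\<close>

definition c_transform :: "'a set \<Rightarrow> ('a \<Rightarrow> 'a \<Rightarrow> real) \<Rightarrow> ('a \<Rightarrow> ereal) \<Rightarrow> 'a \<Rightarrow> ereal" where
  "c_transform X c \<psi> y = (INF z\<in>X. \<psi> z + ereal (c z y))"

text \<open>
  The pairs where the duality gap \<open>\<psi>(x) + c(x, y) - \<psi>'(y)\<close> vanishes are those in the graph of the
  \<open>c\<close>-subdifferential: both say that the infimum defining \<open>\<psi>'(y)\<close> is attained at \<open>x\<close>.
\<close>

lemma c_transform_eq_iff_c_subdiff:
  assumes "x \<in> X" "y \<in> X" "\<bar>\<psi> x\<bar> \<noteq> \<infinity>"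
  shows "c_transform X c \<psi> y = \<psi> x + ereal (c x y) \<longleftrightarrow> y \<in> c_subdiff X c \<psi> x"
proof -
  have "c_transform X c \<psi> y = \<psi> x + ereal (c x y) \<longleftrightarrow> \<psi> x + ereal (c x y) \<le> c_transform X c \<psi> y"
    using assms unfolding c_transform_def by (auto intro: antisym INF_lower)
  also have "\<dots> \<longleftrightarrow> (\<forall>z\<in>X. \<psi> x + ereal (c x y) \<le> \<psi> z + ereal (c z y))"
    by (simp add: c_transform_def le_INF_iff)
  also have "\<dots> \<longleftrightarrow> (\<forall>z\<in>X. \<psi> z \<ge> \<psi> x + ereal (c x y) - ereal (c z y))"
    by (intro ball_cong refl) (simp add: ereal_minus_le_iff add.commute)
  finally show ?thesis using assms by (simp add: c_subdiff_def)
qed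

lemma continuous_on_ereal_add:
  assumes "continuous_on X f"
  shows "continuous_on X (\<lambda>x. a + ereal (f x))"
proof (cases a)
  case (real r)
  have "continuous_on X (\<lambda>x. ereal (r + f x))" using assms by (intro continuous_intros)
  then show ?thesis using real by simp
qed auto

text \<open>
  The index set may be uncountable: the supremum is lower semicontinuous, its superlevel sets being
  unions of open sets.
\<close>

lemma borel_measurable_SUP_continuous:
  fixes f :: "'i \<Rightarrow> 'a::topological_space \<Rightarrow> ereal"
  assumes X: "open X" and f: "\<And>i. i \<in> I \<Longrightarrow> continuous_on X (f i)"
  shows "(\<lambda>x. SUP i\<in>I. f i x) \<in> borel_measurable (borel_on X)"
proof (rule borel_measurableI_greater)
  fix a
  have eq: "{x \<in> space (borel_on X). a < (SUP i\<in>I. f i x)} = (\<Union>i\<in>I. f i -` {a<..} \<inter> X)"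
    by (auto simp: space_restrict_space less_SUP_iff)
  have "open (\<Union>i\<in>I. f i -` {a<..} \<inter> X)"
    using f X by (intro open_UN ballI) (auto simp: continuous_on_open_vimage)
  then show "{x \<in> space (borel_on X). a < (SUP i\<in>I. f i x)} \<in> sets (borel_on X)"
    unfolding eq sets_restrict_space
    by (intro image_eqI[where x = "\<Union>i\<in>I. f i -` {a<..} \<inter> X"]) auto
qed

lemma c_convex_borel_measurable:
  assumes X: "open X" and c: "continuous_on (X \<times> X) (\<lambda>(x, y). c x y)"
    and conv: "c_convex X c \<psi>"
  shows "\<psi> \<in> borel_measurable (borel_on X)"
proof -
  obtain \<zeta> :: "_ \<Rightarrow> ereal" where sup: "\<And>z. z \<in> X \<Longrightarrow> \<psi> z = (SUP y\<in>X. \<zeta> y - ereal (c z y))"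
    using conv unfolding c_convex_def by blast
  have "continuous_on X (\<lambda>z. \<zeta> y + ereal (- c z y))" if "y \<in> X" for y
    using that by (intro continuous_on_ereal_add continuous_on_minus continuous_on_sections(1)[OF c])
  then have "(\<lambda>z. SUP y\<in>X. \<zeta> y + ereal (- c z y)) \<in> borel_measurable (borel_on X)"
    using X by (rule borel_measurable_SUP_continuous[rotated])
  moreover have "\<psi> z = (SUP y\<in>X. \<zeta> y + ereal (- c z y))" if "z \<in> space (borel_on X)" for z
    using sup that by (simp add: space_restrict_space minus_ereal_def)
  ultimately show ?thesis by (simp cong: measurable_cong)
qed

lemma c_transform_borel_measurable:
  assumes X: "open X" and c: "continuous_on (X \<times> X) (\<lambda>(x, y). c x y)"
  shows "c_transform X c \<psi> \<in> borel_measurable (borel_on X)"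
proof -
  have "continuous_on X (\<lambda>y. - (\<psi> z + ereal (c z y)))" if "z \<in> X" for z
  proof -
    have "continuous_on X (\<lambda>y. - \<psi> z + ereal (- c z y))"
      using that by (intro continuous_on_ereal_add continuous_on_minus continuous_on_sections(2)[OF c])
    then show ?thesis by (cases "\<psi> z") auto
  qed
  then have "(\<lambda>y. SUP z\<in>X. - (\<psi> z + ereal (c z y))) \<in> borel_measurable (borel_on X)"
    using X by (rule borel_measurable_SUP_continuous[rotated])
  then have "(\<lambda>y. - (SUP z\<in>X. - (\<psi> z + ereal (c z y)))) \<in> borel_measurable (borel_on X)"
    by measurable
  moreover have "c_transform X c \<psi> = (\<lambda>y. - (SUP z\<in>X. - (\<psi> z + ereal (c z y))))"
    by (simp add: fun_eq_iff c_transform_def ereal_SUP_uminus_eq)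
  ultimately show ?thesis by simp
qed


section \<open>Transport plans carried by graphs\<close>

lemma space_borel_probs: "\<mu> \<in> borel_probs X \<Longrightarrow> space \<mu> = X"
  using sets_eq_imp_space_eq[of \<mu> "borel_on X"] by (simp add: borel_probs_def space_restrict_space)

lemma measurable_borel_probs:
  "\<mu> \<in> borel_probs X \<Longrightarrow> measurable \<mu> N = measurable (borel_on X) N"
  unfolding borel_probs_def by (auto intro: measurable_cong_sets)

lemma push_in_borel_probs:
  assumes "prob_space \<mu>" and "f \<in> \<mu> \<rightarrow>\<^sub>M borel_on X"
  shows "push X f \<mu> \<in> borel_probs X"
  using prob_space.prob_space_distr[OF assms] by (simp add: push_def borel_probs_def)

lemma measurable_graph_map:
  fixes X :: "'a::second_countable_topology set"
  assumes "T \<in> borel_on X \<rightarrow>\<^sub>M borel_on X"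
  shows "(\<lambda>x. (x, T x)) \<in> borel_on X \<rightarrow>\<^sub>M borel_on (X \<times> X)"
proof (rule measurable_restrict_space2)
  have T: "T \<in> borel_measurable (borel_on X)" "T \<in> X \<rightarrow> X"
    using assms by (auto simp: measurable_restrict_space2_iff space_restrict_space)
  then show "(\<lambda>x. (x, T x)) \<in> space (borel_on X) \<rightarrow> X \<times> X" by (auto simp: space_restrict_space)
  show "(\<lambda>x. (x, T x)) \<in> borel_measurable (borel_on X)"
    using measurable_restrict_space1[OF measurable_ident_sets[OF refl]] T(1)
    by (rule borel_measurable_Pair)
qed

lemma measurable_projections_borel_on:
  fixes X :: "'a::second_countable_topology set"
  shows "fst \<in> borel_on (X \<times> X) \<rightarrow>\<^sub>M borel_on X" and "snd \<in> borel_on (X \<times> X) \<rightarrow>\<^sub>M borel_on X"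
  by (auto intro!: measurable_restrict_space3 borel_measurable_continuous_onI continuous_intros)

lemma graph_plan:
  fixes X :: "'a::second_countable_topology set"
  assumes \<mu>: "\<mu> \<in> borel_probs X" and T: "T \<in> transport_maps X \<mu> \<nu>"
  shows "push (X \<times> X) (\<lambda>x. (x, T x)) \<mu> \<in> transport_plans X \<mu> \<nu>"
proof -
  have meas: "T \<in> borel_on X \<rightarrow>\<^sub>M borel_on X" and \<nu>: "push X T \<mu> = \<nu>"
    using T by (auto simp: transport_maps_def)
  have graph: "(\<lambda>x. (x, T x)) \<in> \<mu> \<rightarrow>\<^sub>M borel_on (X \<times> X)"
    using measurable_graph_map[OF meas] by (simp add: measurable_borel_probs[OF \<mu>])
  have "push (X \<times> X) (\<lambda>x. (x, T x)) \<mu> \<in> borel_probs (X \<times> X)"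
    using \<mu> graph by (intro push_in_borel_probs) (auto simp: borel_probs_def)
  moreover have "push X fst (push (X \<times> X) (\<lambda>x. (x, T x)) \<mu>) = \<mu>"
    using \<mu> unfolding push_def distr_distr[OF measurable_projections_borel_on(1) graph]
    by (simp add: comp_def borel_probs_def distr_id2)
  moreover have "push X snd (push (X \<times> X) (\<lambda>x. (x, T x)) \<mu>) = \<nu>"
    using \<nu> unfolding push_def distr_distr[OF measurable_projections_borel_on(2) graph]
    by (simp add: comp_def)
  ultimately show ?thesis by (simp add: transport_plans_def)
qed

lemma plan_cost_graph:
  fixes X :: "'a::second_countable_topology set"
  assumes \<mu>: "\<mu> \<in> borel_probs X" and T: "T \<in> borel_on X \<rightarrow>\<^sub>M borel_on X"
    and c: "(\<lambda>(x, y). c x y) \<in> borel_measurable (borel_on (X \<times> X))"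
  shows "plan_cost c (push (X \<times> X) (\<lambda>x. (x, T x)) \<mu>) = map_cost c \<mu> T"
  using measurable_graph_map[OF T] c
  unfolding plan_cost_def map_cost_def push_def
  by (subst ext_integral_distr) (auto simp: measurable_borel_probs[OF \<mu>])

lemma kantorovich_le_monge:
  fixes X :: "'a::second_countable_topology set"
  assumes \<mu>: "\<mu> \<in> borel_probs X"
    and c: "(\<lambda>(x, y). c x y) \<in> borel_measurable (borel_on (X \<times> X))"
  shows "kantorovich X c \<mu> \<nu> \<le> monge X c \<mu> \<nu>"
  unfolding monge_def
proof (rule INF_greatest)
  fix T assume T: "T \<in> transport_maps X \<mu> \<nu>"
  then have "map_cost c \<mu> T = plan_cost c (push (X \<times> X) (\<lambda>x. (x, T x)) \<mu>)"
    using \<mu> c by (intro plan_cost_graph[symmetric]) (auto simp: transport_maps_def)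
  then show "kantorovich X c \<mu> \<nu> \<le> map_cost c \<mu> T"
    using graph_plan[OF \<mu> T] by (auto simp: kantorovich_def intro: INF_lower)
qed

lemma plan_on_graph_eq_push:
  fixes X :: "'a::second_countable_topology set"
  assumes \<Gamma>: "\<Gamma> \<in> transport_plans X \<mu> \<nu>" and T: "T \<in> borel_on X \<rightarrow>\<^sub>M borel_on X"
    and graph: "AE w in \<Gamma>. snd w = T (fst w)"
  shows "\<Gamma> = push (X \<times> X) (\<lambda>x. (x, T x)) \<mu>"
proof -
  have prob: "\<Gamma> \<in> borel_probs (X \<times> X)" and \<mu>: "\<mu> = distr \<Gamma> (borel_on X) fst"
    using \<Gamma> by (auto simp: transport_plans_def push_def)
  note [simp] = measurable_borel_probs[OF prob]
  have "push (X \<times> X) (\<lambda>x. (x, T x)) \<mu>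
      = distr \<Gamma> (borel_on (X \<times> X)) ((\<lambda>x. (x, T x)) \<circ> fst)"
    unfolding push_def \<mu>
    by (rule distr_distr) (use measurable_graph_map[OF T] measurable_projections_borel_on in auto)
  also have "\<dots> = distr \<Gamma> (borel_on (X \<times> X)) (\<lambda>w. w)"
  proof (rule distr_cong_AE)
    show "AE w in \<Gamma>. ((\<lambda>x. (x, T x)) \<circ> fst) w = w"
      using graph by eventually_elim (auto simp: prod_eq_iff)
    show "(\<lambda>x. (x, T x)) \<circ> fst \<in> \<Gamma> \<rightarrow>\<^sub>M borel_on (X \<times> X)"
      using measurable_comp[OF measurable_projections_borel_on(1) measurable_graph_map[OF T]] by simp
  qed auto
  also have "\<dots> = \<Gamma>" using prob by (simp add: borel_probs_def distr_id2)
  finally show ?thesis by simp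
qed


section \<open>Optimality of a map generated by a \<open>c\<close>-convex potential\<close>

text \<open>
  The duality argument.  The potentials are \<open>u = \<psi>\<close> and \<open>v = \<psi>' - b\<close>, paired with the nonnegative cost
  \<open>k = c - b\<close> where \<open>b\<close> is a lower bound of \<open>c\<close>.  The second part says that a plan no more expensive
  than \<open>T\<close>, at finite cost, has zero duality gap almost everywhere, and there \<open>y \<in> \<partial>\<^sup>c\<psi>(x) = {T(x)}\<close>.
\<close>

lemma potential_map_optimal:
  fixes X :: "'a::euclidean_space set"
  assumes X: "open X" and A: "assumption_A X c" and C: "assumption_C X c"
    and \<mu>: "\<mu> \<in> borel_probs X" and T: "T \<in> borel_on X \<rightarrow>\<^sub>M borel_on X"
    and conv: "c_convex X c \<psi>"
    and grad: "AE x in \<mu>. ereal_differentiable_at \<psi> x \<and>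
      ereal_gradient \<psi> x + gradient (\<lambda>z. c z (T x)) x = 0"
    and \<Gamma>: "\<Gamma> \<in> transport_plans X \<mu> (push X T \<mu>)"
  shows "map_cost c \<mu> T \<le> plan_cost c \<Gamma>"
    and "plan_cost c \<Gamma> \<le> map_cost c \<mu> T \<Longrightarrow> map_cost c \<mu> T < \<infinity> \<Longrightarrow> AE w in \<Gamma>. snd w = T (fst w)"
proof -
  have c_cont: "continuous_on (X \<times> X) (\<lambda>(x, y). c x y)" using A by (simp add: assumption_A_def)
  then have c_meas: "(\<lambda>(x, y). c x y) \<in> borel_measurable (borel_on (X \<times> X))"
    by (rule borel_measurable_continuous_on_restrict)
  obtain b where b: "\<And>x y. x \<in> X \<Longrightarrow> y \<in> X \<Longrightarrow> b \<le> c x y"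
    using A by (auto simp: assumption_A_def)
  have \<Gamma>_prob: "\<Gamma> \<in> borel_probs (X \<times> X)"
    and fst: "distr \<Gamma> (borel_on X) fst = \<mu>" and snd: "distr \<Gamma> (borel_on X) snd = push X T \<mu>"
    using \<Gamma> by (auto simp: transport_plans_def push_def)
  have TX: "T x \<in> X" if "x \<in> X" for x
    using measurable_space[OF T] that by (simp add: space_restrict_space)
  note meas = measurable_borel_probs[OF \<mu>] measurable_borel_probs[OF \<Gamma>_prob]
  note space = space_borel_probs[OF \<mu>] space_borel_probs[OF \<Gamma>_prob]
  have proj_meas: "fst \<in> \<Gamma> \<rightarrow>\<^sub>M borel_on X" "snd \<in> \<Gamma> \<rightarrow>\<^sub>M borel_on X"
    using measurable_projections_borel_on[of X] by (simp_all add: meas)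
  define \<psi>' where "\<psi>' = c_transform X c \<psi>"
  define u where "u x = real_of_ereal (\<psi> x)" for x
  define v where "v y = real_of_ereal (\<psi>' y) - b" for y
  define k where "k w = c (fst w) (snd w) - b" for w
  have \<psi>'_meas: "\<psi>' \<in> borel_measurable (borel_on X)"
    unfolding \<psi>'_def using X c_cont by (rule c_transform_borel_measurable)
  have \<psi>_meas: "\<psi> \<in> borel_measurable (borel_on X)"
    using X c_cont conv by (rule c_convex_borel_measurable)
  have k_meas: "k \<in> borel_measurable (borel_on (X \<times> X))"
    using borel_measurable_diff[OF c_meas borel_measurable_const[of b]]
    by (simp add: k_def[abs_def] split_beta)
  have regular: "AE x in \<mu>. x \<in> X \<and> \<bar>\<psi> x\<bar> \<noteq> \<infinity> \<and> c_subdiff X c \<psi> x = {T x}"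
    using grad AE_space
  proof eventually_elim
    case (elim x)
    then have "x \<in> X" by (simp add: space)
    moreover have "\<bar>\<psi> x\<bar> \<noteq> \<infinity>"
      using elim unfolding ereal_differentiable_at_def by (auto dest: eventually_nhds_x_imp_x)
    moreover have "c_subdiff X c \<psi> x = {T x}"
      using elim TX \<open>x \<in> X\<close> by (intro c_subdiff_eq_singleton[OF A C X _ conv]) auto
    ultimately show ?case by blast
  qed
  have match: "AE x in \<mu>. \<psi>' (T x) = \<psi> x + ereal (c x (T x)) \<and> \<bar>\<psi> x\<bar> \<noteq> \<infinity>"
    using regular
  proof eventually_elim
    case (elim x)
    then show ?case
      using c_transform_eq_iff_c_subdiff[of x X "T x" \<psi> c] TX by (simp add: \<psi>'_def)
  qed
  \<comment> \<open>Real-valued potentials represent \<open>\<psi>\<close> and \<open>\<psi>'\<close> faithfully only at points of finiteness; \<open>\<psi>'\<close> is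
    finite on the image of \<open>T\<close>, hence almost everywhere for the second marginal of any plan.\<close>
  have "AE y in push X T \<mu>. \<bar>\<psi>' y\<bar> \<noteq> \<infinity>"
  proof -
    have "AE x in \<mu>. \<bar>\<psi>' (T x)\<bar> \<noteq> \<infinity>"
      using match by eventually_elim auto
    moreover have "{y \<in> space (borel_on X). \<bar>\<psi>' y\<bar> \<noteq> \<infinity>} \<in> sets (borel_on X)"
      using \<psi>'_meas by measurable
    ultimately show ?thesis
      unfolding push_def using T by (subst AE_distr_iff) (auto simp: meas)
  qed
  then have "AE w in \<Gamma>. \<bar>\<psi>' (snd w)\<bar> \<noteq> \<infinity>"
    unfolding snd[symmetric] by (rule AE_distrD[OF proj_meas(2)])
  moreover have "AE w in \<Gamma>. fst w \<in> X \<and> \<bar>\<psi> (fst w)\<bar> \<noteq> \<infinity> \<and> c_subdiff X c \<psi> (fst w) = {T (fst w)}"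
    using AE_distrD[OF proj_meas(1), unfolded fst, OF regular] .
  ultimately have good: "AE w in \<Gamma>. w \<in> X \<times> X \<and> \<bar>\<psi>' (snd w)\<bar> \<noteq> \<infinity> \<and> \<bar>\<psi> (fst w)\<bar> \<noteq> \<infinity> \<and>
      c_subdiff X c \<psi> (fst w) = {T (fst w)}"
    using AE_space by eventually_elim (auto simp: space)
  have gap: "AE w in \<Gamma>. v (snd w) - u (fst w) \<le> k w"
    using good
  proof eventually_elim
    case (elim w)
    then have "\<psi>' (snd w) \<le> \<psi> (fst w) + ereal (c (fst w) (snd w))"
      unfolding \<psi>'_def c_transform_def by (intro INF_lower) auto
    then show ?case
      using elim by (cases "\<psi>' (snd w)"; cases "\<psi> (fst w)") (auto simp: u_def v_def k_def)
  qed
  have match': "AE x in \<mu>. v (T x) - u x = c x (T x) - b"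
    using match by eventually_elim (auto simp: u_def v_def)
  have le: "(\<integral>\<^sup>+w. ennreal (k w - (v (snd w) - u (fst w))) \<partial>\<Gamma>) + (\<integral>\<^sup>+x. ennreal (v (T x) - u x) \<partial>\<mu>)
      \<le> (\<integral>\<^sup>+w. ennreal (k w) \<partial>\<Gamma>)"
  proof (rule duality_gap_le[where N = "borel_on X"])
    show "prob_space \<Gamma>" using \<Gamma>_prob by (simp add: borel_probs_def)
    have sets_\<mu>: "sets \<mu> = sets (borel_on X)" using \<mu> by (simp add: borel_probs_def)
    have "distr \<Gamma> \<mu> fst = distr \<Gamma> (borel_on X) fst" by (rule distr_cong[OF refl sets_\<mu> refl])
    then show "distr \<Gamma> \<mu> fst = \<mu>" by (rule trans[OF _ fst])
    show "fst \<in> \<Gamma> \<rightarrow>\<^sub>M \<mu>"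
      using proj_meas(1) unfolding measurable_cong_sets[OF refl sets_\<mu>] .
    show "distr \<Gamma> (borel_on X) snd = distr \<mu> (borel_on X) T" using snd by (simp add: push_def)
    show "AE w in \<Gamma>. 0 \<le> k w" using b by (intro AE_I2) (auto simp: space k_def)
    show "AE x in \<mu>. 0 \<le> v (T x) - u x"
      using match' AE_space by eventually_elim (auto simp: space b TX)
    show "v \<in> borel_measurable (borel_on X)" unfolding v_def using \<psi>'_meas by measurable
    show "u \<in> borel_measurable \<mu>" unfolding u_def meas using \<psi>_meas by measurable
  qed (simp_all add: T measurable_projections_borel_on k_meas gap meas)
  have "(\<integral>\<^sup>+x. ennreal (v (T x) - u x) \<partial>\<mu>) = (\<integral>\<^sup>+x. ennreal (c x (T x) - b) \<partial>\<mu>)"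
    using match' by (intro nn_integral_cong_AE) (auto elim: eventually_mono)
  note le = le[unfolded this]
  have map: "map_cost c \<mu> T = enn2ereal (\<integral>\<^sup>+x. ennreal (c x (T x) - b) \<partial>\<mu>) + ereal b"
    unfolding map_cost_def
  proof (rule ext_integral_bounded_below)
    show "(\<lambda>x. c x (T x)) \<in> borel_measurable \<mu>"
      using measurable_compose[OF measurable_graph_map[OF T] c_meas] by (simp add: meas)
  qed (use \<mu> b TX in \<open>auto simp: borel_probs_def space\<close>)
  have plan: "plan_cost c \<Gamma> = enn2ereal (\<integral>\<^sup>+w. ennreal (k w) \<partial>\<Gamma>) + ereal b"
    unfolding plan_cost_def k_def split_beta
    by (rule ext_integral_bounded_below)
       (use \<Gamma>_prob b c_meas[unfolded split_beta] in \<open>auto simp: borel_probs_def space meas\<close>)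
  show "map_cost c \<mu> T \<le> plan_cost c \<Gamma>"
  proof -
    have "(\<integral>\<^sup>+x. ennreal (c x (T x) - b) \<partial>\<mu>) \<le> (\<integral>\<^sup>+w. ennreal (k w) \<partial>\<Gamma>)"
      using le by (rule order_trans[rotated]) simp
    then show ?thesis unfolding map plan by (intro add_mono) (simp_all add: less_eq_ennreal.rep_eq)
  qed
  assume opt: "plan_cost c \<Gamma> \<le> map_cost c \<mu> T" and fin: "map_cost c \<mu> T < \<infinity>"
  have "(\<integral>\<^sup>+w. ennreal (k w) \<partial>\<Gamma>) \<le> (\<integral>\<^sup>+x. ennreal (c x (T x) - b) \<partial>\<mu>)"
    using opt unfolding map plan by (simp add: less_eq_ennreal.rep_eq ereal_add_le_add_iff2)
  moreover have "(\<integral>\<^sup>+x. ennreal (c x (T x) - b) \<partial>\<mu>) \<noteq> \<infinity>"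
    using fin unfolding map by auto
  ultimately have zero: "(\<integral>\<^sup>+w. ennreal (k w - (v (snd w) - u (fst w))) \<partial>\<Gamma>) = 0"
    using le by (metis (no_types, lifting) add.commute ennreal_add_left_cancel_le infinity_ennreal_def
        add.right_neutral order_trans le_zero_eq)
  have "(\<lambda>w. ennreal (k w - (v (snd w) - u (fst w)))) \<in> borel_measurable (borel_on (X \<times> X))"
    unfolding u_def v_def
    using k_meas measurable_compose[OF measurable_projections_borel_on(1) \<psi>_meas]
      measurable_compose[OF measurable_projections_borel_on(2) \<psi>'_meas]
    by measurable
  then have "AE w in \<Gamma>. ennreal (k w - (v (snd w) - u (fst w))) = 0"
    using zero by (subst (asm) nn_integral_0_iff_AE) (auto simp: meas)
  with good gap show "AE w in \<Gamma>. snd w = T (fst w)"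
  proof eventually_elim
    case (elim w)
    then have "k w = v (snd w) - u (fst w)" by (simp add: ennreal_eq_0_iff)
    then have "\<psi>' (snd w) = \<psi> (fst w) + ereal (c (fst w) (snd w))"
      using elim by (cases "\<psi>' (snd w)"; cases "\<psi> (fst w)") (auto simp: u_def v_def k_def)
    moreover have "fst w \<in> X" "snd w \<in> X" "\<bar>\<psi> (fst w)\<bar> \<noteq> \<infinity>"
      using elim(1) by (simp_all add: mem_Times_iff)
    ultimately have "snd w \<in> c_subdiff X c \<psi> (fst w)"
      unfolding \<psi>'_def by (rule c_transform_eq_iff_c_subdiff[THEN iffD1, rotated 3])
    then show ?case using elim(1) by simp
  qed
qed


section \<open>Transport maps from the group action\<close>

lemma smooth_action_measurable:
  assumes "smooth_action G M X \<alpha>" and "g \<in> carrier G"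
  shows "\<alpha> g \<in> borel_on X \<rightarrow>\<^sub>M borel_on X"
proof -
  have "\<alpha> g \<in> carrier (DiffGroup X)"
    using assms by (auto simp: smooth_action_def hom_def)
  then have "continuous_map (top_of_set X) (top_of_set X) (\<alpha> g)"
    by (simp add: DiffGroup_def smooth_map_def open_mfd_def)
  then have "continuous_on X (\<alpha> g)" "\<alpha> g \<in> X \<rightarrow> X"
    by (auto simp: continuous_map_in_subtopology)
  then show ?thesis
    by (auto intro!: measurable_restrict_space2 borel_measurable_continuous_on_restrict
        simp: space_restrict_space)
qed

lemma smooth_action_mult:
  assumes "smooth_action G M X \<alpha>" and "g \<in> carrier G" and "h \<in> carrier G" and "x \<in> X"
  shows "\<alpha> (g \<otimes>\<^bsub>G\<^esub> h) x = \<alpha> g (\<alpha> h x)"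
proof -
  have "\<alpha> g \<in> Bij X" "\<alpha> h \<in> Bij X" "\<alpha> (g \<otimes>\<^bsub>G\<^esub> h) = \<alpha> g \<otimes>\<^bsub>DiffGroup X\<^esub> \<alpha> h"
    using assms by (auto simp: smooth_action_def hom_def DiffGroup_def)
  then show ?thesis using assms by (simp add: DiffGroup_def BijGroup_def compose_eq)
qed

text \<open>
  Both claims rest on \<open>T \<circ> \<alpha>(g0) = \<alpha>(g1 h) = \<alpha>(g1) \<circ> \<alpha>(h)\<close> on \<open>X\<close>, where \<open>\<alpha>(h)\<close> preserves \<open>\<rho>\<close>.
\<close>

lemma stabilizer_transport_map:
  assumes G: "group G" and act: "smooth_action G M X \<alpha>" and \<rho>: "\<rho> \<in> borel_probs X"
    and g: "g0 \<in> carrier G" "g1 \<in> carrier G" and h: "h \<in> measure_stab G X \<alpha> \<rho>"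
  defines "T \<equiv> \<alpha> (g1 \<otimes>\<^bsub>G\<^esub> h \<otimes>\<^bsub>G\<^esub> inv\<^bsub>G\<^esub> g0)"
  shows "T \<in> transport_maps X (push X (\<alpha> g0) \<rho>) (push X (\<alpha> g1) \<rho>)"
    and "(\<lambda>(x, y). c x y) \<in> borel_measurable (borel_on (X \<times> X)) \<Longrightarrow>
      map_cost c (push X (\<alpha> g0) \<rho>) T = orbit_cost G \<alpha> \<rho> c g0 g1 h"
proof -
  interpret group G by fact
  have hG: "h \<in> carrier G" and stab: "push X (\<alpha> h) \<rho> = \<rho>" using h by (auto simp: measure_stab_def)
  note act_meas = smooth_action_measurable[OF act] and act_mult = smooth_action_mult[OF act]
  note meas = measurable_borel_probs[OF \<rho>] and space = space_borel_probs[OF \<rho>]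
  have T: "T \<in> borel_on X \<rightarrow>\<^sub>M borel_on X" unfolding T_def using g hG by (intro act_meas) auto
  have T_g0: "T (\<alpha> g0 x) = \<alpha> (g1 \<otimes>\<^bsub>G\<^esub> h) x" if "x \<in> X" for x
  proof -
    have "T (\<alpha> g0 x) = \<alpha> (g1 \<otimes>\<^bsub>G\<^esub> h \<otimes>\<^bsub>G\<^esub> inv\<^bsub>G\<^esub> g0 \<otimes>\<^bsub>G\<^esub> g0) x"
      unfolding T_def using g hG that by (intro act_mult[symmetric]) auto
    also have "g1 \<otimes>\<^bsub>G\<^esub> h \<otimes>\<^bsub>G\<^esub> inv\<^bsub>G\<^esub> g0 \<otimes>\<^bsub>G\<^esub> g0 = g1 \<otimes>\<^bsub>G\<^esub> h"
      using g hG by (simp add: m_assoc)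
    finally show ?thesis .
  qed
  have "push X T (push X (\<alpha> g0) \<rho>) = distr \<rho> (borel_on X) (T \<circ> \<alpha> g0)"
    unfolding push_def using T act_meas[OF g(1)] by (intro distr_distr) (auto simp: meas)
  also have "\<dots> = distr \<rho> (borel_on X) (\<alpha> g1 \<circ> \<alpha> h)"
    using T_g0 act_mult g hG by (intro distr_cong) (auto simp: space)
  also have "\<dots> = push X (\<alpha> g1) (push X (\<alpha> h) \<rho>)"
    unfolding push_def using act_meas g hG by (intro distr_distr[symmetric]) (auto simp: meas)
  finally show "T \<in> transport_maps X (push X (\<alpha> g0) \<rho>) (push X (\<alpha> g1) \<rho>)"
    using T stab by (simp add: transport_maps_def)
  assume c: "(\<lambda>(x, y). c x y) \<in> borel_measurable (borel_on (X \<times> X))"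
  have "(\<lambda>x. c x (T x)) \<in> borel_measurable (borel_on X)"
    using measurable_compose[OF measurable_graph_map[OF T] c] by simp
  then have "map_cost c (push X (\<alpha> g0) \<rho>) T = ext_integral \<rho> (\<lambda>x. c (\<alpha> g0 x) (T (\<alpha> g0 x)))"
    unfolding map_cost_def push_def using act_meas[OF g(1)]
    by (intro ext_integral_distr) (auto simp: meas)
  also have "\<dots> = orbit_cost G \<alpha> \<rho> c g0 g1 h"
    unfolding orbit_cost_def using T_g0 by (intro ext_integral_cong) (simp add: space)
  finally show "map_cost c (push X (\<alpha> g0) \<rho>) T = orbit_cost G \<alpha> \<rho> c g0 g1 h" .
qed

lemma monge_le_orbit_transport:
  assumes "group G" and "smooth_action G M X \<alpha>" and "\<rho> \<in> borel_probs X"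
    and "g0 \<in> carrier G" and "g1 \<in> carrier G"
    and "(\<lambda>(x, y). c x y) \<in> borel_measurable (borel_on (X \<times> X))"
  shows "monge X c (push X (\<alpha> g0) \<rho>) (push X (\<alpha> g1) \<rho>) \<le> orbit_transport G X \<alpha> \<rho> c g0 g1"
  unfolding orbit_transport_def
proof (rule INF_greatest)
  fix h assume h: "h \<in> measure_stab G X \<alpha> \<rho>"
  show "monge X c (push X (\<alpha> g0) \<rho>) (push X (\<alpha> g1) \<rho>) \<le> orbit_cost G \<alpha> \<rho> c g0 g1 h"
    using stabilizer_transport_map[OF assms(1-5) h] assms(6)
    by (metis (no_types, lifting) monge_def INF_lower)
qed


section \<open>Orbit transport and optimal transport\<close>

theorem theorem4p1:
  fixes X :: "(real ^ 'n) set"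
    and G :: "('g, 'm) monoid_scheme"
    and M :: "('g, 'e::euclidean_space) mfd"
    and \<alpha> :: "'g \<Rightarrow> real ^ 'n \<Rightarrow> real ^ 'n"
    and \<rho> \<mu>0 \<mu>1 :: "(real ^ 'n) measure"
    and c :: "real ^ 'n \<Rightarrow> real ^ 'n \<Rightarrow> real"
    and g0 g1 :: 'g
  assumes "open X" and "X \<noteq> {}"
    and "lie_group G M"
    and "smooth_action G M X \<alpha>"
    and "\<rho> \<in> borel_probs X"
    and "absolutely_continuous (restrict_space lborel X) \<rho>"
    and "(\<lambda>(x, y). c x y) \<in> borel_measurable (borel_on (X \<times> X))"
    and "g0 \<in> carrier G" and "g1 \<in> carrier G"
    and "\<mu>0 = push X (\<alpha> g0) \<rho>" and "\<mu>1 = push X (\<alpha> g1) \<rho>"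
  shows
    "monge X c \<mu>0 \<mu>1 \<le> orbit_transport G X \<alpha> \<rho> c g0 g1 \<and>
     (kantorovich X c \<mu>0 \<mu>1 < \<infinity> \<and> assumption_A X c \<and> assumption_C X c \<and> assumption_B X c \<mu>0 \<longrightarrow>
       (\<forall>h\<in>measure_stab G X \<alpha> \<rho>. \<forall>\<phi> T.
          T = \<alpha> (g1 \<otimes>\<^bsub>G\<^esub> h \<otimes>\<^bsub>G\<^esub> inv\<^bsub>G\<^esub> g0) \<and> c_convex X c \<phi> \<and>
          (AE x in \<mu>0. ereal_differentiable_at \<phi> x \<and>
             ereal_gradient \<phi> x + gradient (\<lambda>z. c z (T x)) x = 0) \<longrightarrow>
          (T \<in> transport_maps X \<mu>0 \<mu>1 \<and> map_cost c \<mu>0 T = monge X c \<mu>0 \<mu>1 \<and>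
           (\<forall>T'\<in>transport_maps X \<mu>0 \<mu>1. map_cost c \<mu>0 T' = monge X c \<mu>0 \<mu>1 \<longrightarrow>
              (AE x in \<mu>0. T' x = T x))) \<and>
          orbit_cost G \<alpha> \<rho> c g0 g1 h = orbit_transport G X \<alpha> \<rho> c g0 g1 \<and>
          (push (X \<times> X) (\<lambda>x. (x, T x)) \<mu>0 \<in> transport_plans X \<mu>0 \<mu>1 \<and>
           plan_cost c (push (X \<times> X) (\<lambda>x. (x, T x)) \<mu>0) = kantorovich X c \<mu>0 \<mu>1 \<and>
           (\<forall>\<Gamma>\<in>transport_plans X \<mu>0 \<mu>1. plan_cost c \<Gamma> = kantorovich X c \<mu>0 \<mu>1 \<longrightarrow>
              \<Gamma> = push (X \<times> X) (\<lambda>x. (x, T x)) \<mu>0)) \<and>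
          kantorovich X c \<mu>0 \<mu>1 = monge X c \<mu>0 \<mu>1 \<and>
          monge X c \<mu>0 \<mu>1 = orbit_transport G X \<alpha> \<rho> c g0 g1))"
proof (rule conjI[rotated], intro impI ballI allI, elim conjE)
  have grp: "group G" using assms(3) by (simp add: lie_group_def)
  note c = assms(7)
  note \<mu>_eq = assms(10,11)
  show monge_le: "monge X c \<mu>0 \<mu>1 \<le> orbit_transport G X \<alpha> \<rho> c g0 g1"
    unfolding \<mu>_eq using grp assms by (intro monge_le_orbit_transport) auto
  have \<mu>0: "\<mu>0 \<in> borel_probs X"
    unfolding \<mu>_eq using assms(5) smooth_action_measurable[OF assms(4,8)]
    by (intro push_in_borel_probs) (auto simp: measurable_borel_probs, simp add: borel_probs_def)
  have orbit_le: "orbit_transport G X \<alpha> \<rho> c g0 g1 \<le> orbit_cost G \<alpha> \<rho> c g0 g1 h"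
    if "h \<in> measure_stab G X \<alpha> \<rho>" for h
    using that unfolding orbit_transport_def by (rule INF_lower)
  fix h \<phi> T
  assume fin: "kantorovich X c \<mu>0 \<mu>1 < \<infinity>" and A: "assumption_A X c" and C: "assumption_C X c"
    and h: "h \<in> measure_stab G X \<alpha> \<rho>"
    and T_eq: "T = \<alpha> (g1 \<otimes>\<^bsub>G\<^esub> h \<otimes>\<^bsub>G\<^esub> inv\<^bsub>G\<^esub> g0)" and conv: "c_convex X c \<phi>"
    and grad: "AE x in \<mu>0. ereal_differentiable_at \<phi> x \<and>
      ereal_gradient \<phi> x + gradient (\<lambda>z. c z (T x)) x = 0"
  have T: "T \<in> transport_maps X \<mu>0 \<mu>1" and cost_T: "map_cost c \<mu>0 T = orbit_cost G \<alpha> \<rho> c g0 g1 h"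
    using stabilizer_transport_map[OF grp assms(4,5,8,9) h] c unfolding \<mu>_eq T_eq by blast+
  then have T_meas: "T \<in> borel_on X \<rightarrow>\<^sub>M borel_on X" and push_T: "push X T \<mu>0 = \<mu>1"
    by (auto simp: transport_maps_def)
  note optimal = potential_map_optimal[OF assms(1) A C \<mu>0 T_meas conv grad, unfolded push_T]
  let ?\<Gamma> = "push (X \<times> X) (\<lambda>x. (x, T x)) \<mu>0"
  have plan: "?\<Gamma> \<in> transport_plans X \<mu>0 \<mu>1" using \<mu>0 T by (rule graph_plan)
  have plan_cost: "plan_cost c ?\<Gamma> = map_cost c \<mu>0 T" using \<mu>0 T_meas c by (rule plan_cost_graph)
  have "map_cost c \<mu>0 T \<le> kantorovich X c \<mu>0 \<mu>1"
    unfolding kantorovich_def using optimal(1) by (rule INF_greatest)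
  \<comment> \<open>Together with \<open>K \<le> M \<le> J \<le>\<close> cost of \<open>h =\<close> cost of \<open>T\<close>, this makes all the values equal.\<close>
  moreover have "kantorovich X c \<mu>0 \<mu>1 \<le> monge X c \<mu>0 \<mu>1"
    using \<mu>0 c by (rule kantorovich_le_monge)
  ultimately have cost_K: "map_cost c \<mu>0 T = kantorovich X c \<mu>0 \<mu>1"
    and cost_M: "map_cost c \<mu>0 T = monge X c \<mu>0 \<mu>1"
    and cost_J: "map_cost c \<mu>0 T = orbit_transport G X \<alpha> \<rho> c g0 g1"
    using monge_le orbit_le[OF h] cost_T by auto
  have graph: "AE w in \<Gamma>. snd w = T (fst w)"
    if "\<Gamma> \<in> transport_plans X \<mu>0 \<mu>1" "plan_cost c \<Gamma> = kantorovich X c \<mu>0 \<mu>1" for \<Gamma>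
    using optimal(2)[OF that(1)] that(2) cost_K fin by simp
  have unique_plan: "\<Gamma> = ?\<Gamma>"
    if "\<Gamma> \<in> transport_plans X \<mu>0 \<mu>1" "plan_cost c \<Gamma> = kantorovich X c \<mu>0 \<mu>1" for \<Gamma>
    using that(1) T_meas graph[OF that] by (rule plan_on_graph_eq_push)
  have unique_map: "AE x in \<mu>0. T' x = T x"
    if T': "T' \<in> transport_maps X \<mu>0 \<mu>1" and opt: "map_cost c \<mu>0 T' = monge X c \<mu>0 \<mu>1" for T'
  proof -
    have T'_meas: "T' \<in> borel_on X \<rightarrow>\<^sub>M borel_on X" using T' by (simp add: transport_maps_def)
    let ?\<Gamma>' = "push (X \<times> X) (\<lambda>x. (x, T' x)) \<mu>0"
    have "plan_cost c ?\<Gamma>' = kantorovich X c \<mu>0 \<mu>1"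
      using plan_cost_graph[OF \<mu>0 T'_meas c] opt cost_M cost_K by simp
    then have "AE w in ?\<Gamma>'. snd w = T (fst w)" using graph graph_plan[OF \<mu>0 T'] by blast
    moreover have "(\<lambda>x. (x, T' x)) \<in> \<mu>0 \<rightarrow>\<^sub>M borel_on (X \<times> X)"
      using measurable_graph_map[OF T'_meas] by (simp add: measurable_borel_probs[OF \<mu>0])
    ultimately show ?thesis unfolding push_def by (auto dest: AE_distrD[rotated])
  qed
  show "(T \<in> transport_maps X \<mu>0 \<mu>1 \<and> map_cost c \<mu>0 T = monge X c \<mu>0 \<mu>1 \<and>
         (\<forall>T'\<in>transport_maps X \<mu>0 \<mu>1. map_cost c \<mu>0 T' = monge X c \<mu>0 \<mu>1 \<longrightarrow>
            (AE x in \<mu>0. T' x = T x))) \<and>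
        orbit_cost G \<alpha> \<rho> c g0 g1 h = orbit_transport G X \<alpha> \<rho> c g0 g1 \<and>
        (?\<Gamma> \<in> transport_plans X \<mu>0 \<mu>1 \<and>
         plan_cost c ?\<Gamma> = kantorovich X c \<mu>0 \<mu>1 \<and>
         (\<forall>\<Gamma>\<in>transport_plans X \<mu>0 \<mu>1. plan_cost c \<Gamma> = kantorovich X c \<mu>0 \<mu>1 \<longrightarrow> \<Gamma> = ?\<Gamma>)) \<and>
        kantorovich X c \<mu>0 \<mu>1 = monge X c \<mu>0 \<mu>1 \<and>
        monge X c \<mu>0 \<mu>1 = orbit_transport G X \<alpha> \<rho> c g0 g1"
  proof (intro conjI ballI impI)
    show "orbit_cost G \<alpha> \<rho> c g0 g1 h = orbit_transport G X \<alpha> \<rho> c g0 g1"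
      using cost_T cost_J by (rule subst)
    show "plan_cost c ?\<Gamma> = kantorovich X c \<mu>0 \<mu>1" using plan_cost cost_K by (rule trans)
    show "kantorovich X c \<mu>0 \<mu>1 = monge X c \<mu>0 \<mu>1" using cost_K cost_M by (rule subst)
    show "monge X c \<mu>0 \<mu>1 = orbit_transport G X \<alpha> \<rho> c g0 g1"
      using cost_M cost_J by (rule subst)
  qed (fact T plan cost_M | (rule unique_map unique_plan; assumption))+
qed

end
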